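(* Let $\mathfrak d_4$ be the four dimensional real Lie algebra with basis $e_0,e_1,e_2,e_3$ and nonzero brackets (up to skew-symmetry) $[e_0,e_1]=e_1$, $[e_0,e_2]=-e_2$, $[e_1,e_2]=e_3$. Then $\mathfrak d_4$ is, up to isomorphism, the unique four dimensional real solvable Lie algebra admitting generalized complex structures of type $2$, but not of type $0$ or $1$.
   Context: A generalized complex structure on a real Lie algebra $\mathfrak g$ is an endomorphism $\mathcal J$ of $\mathfrak g\oplus\mathfrak g^*$ with $\mathcal J^2=-\mathrm{Id}$, orthogonal with respect to $\langle (x,\alpha),(y,\beta)\rangle=\frac12(\beta(x)+\alpha(y))$, and satisfying $[u,v]+\mathcal J[\mathcal Ju,v]+\mathcal J[u,\mathcal Jv]-[\mathcal Ju,\mathcal Jv]=0$ for all $u,v\in\mathfrak g\oplus\mathfrak g^*$, where $[(x,\alpha),(y,\beta)]=([x,y],-\beta\circ\mathrm{ad}(x)+\alpha\circ\mathrm{ad}(y))$. Write $\mathcal J=\begin{pmatrix}\mathcal J_1&\mathcal J_2\\ \mathcal J_3&\mathcal J_4\end{pmatrix}$ with respect to $\mathfrak g\oplus\mathfrak g^*$, so $\mathcal J_2:\mathfrak g^*\to\mathfrak g$. If $\dim\mathfrak g=2n$, $\mathcal J$ is of type $k$ when $\operatorname{rank}(\mathcal J_2)=2(n-k)$. *)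

theory Defs
  imports "HOL-Analysis.Analysis"
begin

section \<open>The algebraic dual of a real vector space\<close>

typedef (overloaded) 'a dual = "{f :: 'a::real_vector \<Rightarrow> real. linear f}"
  morphisms dual_apply Abs_dual
  by (auto intro: module_hom_zero)

setup_lifting type_definition_dual

instantiation dual :: (real_vector) real_vector
begin

lift_definition zero_dual :: "'a dual" is "\<lambda>x. 0"
  by (rule module_hom_zero)

lift_definition plus_dual :: "'a dual \<Rightarrow> 'a dual \<Rightarrow> 'a dual" is "\<lambda>f g x. f x + g x"
  by (rule linear_compose_add)

lift_definition minus_dual :: "'a dual \<Rightarrow> 'a dual \<Rightarrow> 'a dual" is "\<lambda>f g x. f x - g x"
  by (rule linear_compose_sub)

lift_definition uminus_dual :: "'a dual \<Rightarrow> 'a dual" is "\<lambda>f x. - f x"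
  by (rule linear_compose_neg)

lift_definition scaleR_dual :: "real \<Rightarrow> 'a dual \<Rightarrow> 'a dual" is "\<lambda>c f x. c *\<^sub>R f x"
  by (rule linear_compose_scale_right)

instance
  by standard (transfer; auto simp: algebra_simps)+

end

section \<open>Real Lie algebras\<close>

text \<open>A Lie algebra is a bracket on the whole of a type of class \<open>real_vector\<close>.\<close>

definition lie_algebra :: "('a::real_vector \<Rightarrow> 'a \<Rightarrow> 'a) \<Rightarrow> bool" where
  "lie_algebra br \<longleftrightarrow>
     bilinear br \<and>
     (\<forall>x. br x x = 0) \<and>
     (\<forall>x y z. br x (br y z) + br y (br z x) + br z (br x y) = 0)"

definition derived_subspace :: "('a::real_vector \<Rightarrow> 'a \<Rightarrow> 'a) \<Rightarrow> 'a set \<Rightarrow> 'a set" where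
  "derived_subspace br S = span {br x y |x y. x \<in> S \<and> y \<in> S}"

definition lie_solvable :: "('a::real_vector \<Rightarrow> 'a \<Rightarrow> 'a) \<Rightarrow> bool" where
  "lie_solvable br \<longleftrightarrow> (\<exists>m. (derived_subspace br ^^ m) UNIV = {0})"

definition lie_isomorphic ::
  "('a::real_vector \<Rightarrow> 'a \<Rightarrow> 'a) \<Rightarrow> ('b::real_vector \<Rightarrow> 'b \<Rightarrow> 'b) \<Rightarrow> bool" where
  "lie_isomorphic br br' \<longleftrightarrow>
     (\<exists>\<phi>. linear \<phi> \<and> bij \<phi> \<and> (\<forall>x y. \<phi> (br x y) = br' (\<phi> x) (\<phi> y)))"

section \<open>Generalized complex structures\<close>

definition gc_pairing :: "'a::real_vector \<times> 'a dual \<Rightarrow> 'a \<times> 'a dual \<Rightarrow> real" where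
  "gc_pairing u v = (dual_apply (snd v) (fst u) + dual_apply (snd u) (fst v)) / 2"

text \<open>
  The bracket on \<open>\<gg> \<oplus> \<gg>\<^sup>*\<close>. The argument of \<open>Abs_dual\<close> is a linear functional as soon as
  \<open>br\<close> is bilinear, see \<open>dual_apply_snd_cotangent_bracket\<close> below; otherwise the value is
  unspecified.
\<close>

definition cotangent_bracket ::
  "('a::real_vector \<Rightarrow> 'a \<Rightarrow> 'a) \<Rightarrow> 'a \<times> 'a dual \<Rightarrow> 'a \<times> 'a dual \<Rightarrow> 'a \<times> 'a dual" where
  "cotangent_bracket br u v =
     (br (fst u) (fst v),
      Abs_dual (\<lambda>z. - dual_apply (snd v) (br (fst u) z) + dual_apply (snd u) (br (fst v) z)))"

lemma dual_apply_snd_cotangent_bracket: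
  assumes "lie_algebra br"
  shows "dual_apply (snd (cotangent_bracket br (x, \<alpha>) (y, \<beta>))) z =
    - dual_apply \<beta> (br x z) + dual_apply \<alpha> (br y z)"
proof -
  have br: "linear (br w)" for w
    using assms by (simp add: lie_algebra_def bilinear_def)
  have ap: "linear (dual_apply \<gamma>)" for \<gamma> :: "'a dual"
    using dual_apply[of \<gamma>] by simp
  have "linear (\<lambda>z. - dual_apply \<beta> (br x z) + dual_apply \<alpha> (br y z))"
    using linear_compose[OF br ap] unfolding o_def
    by (intro linear_compose_add linear_compose_neg)
  then show ?thesis
    by (simp add: cotangent_bracket_def Abs_dual_inverse)
qed

definition generalized_complex_structure ::
  "('a::real_vector \<Rightarrow> 'a \<Rightarrow> 'a) \<Rightarrow> ('a \<times> 'a dual \<Rightarrow> 'a \<times> 'a dual) \<Rightarrow> bool" where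
  "generalized_complex_structure br J \<longleftrightarrow>
     linear J \<and>
     (\<forall>u. J (J u) = - u) \<and>
     (\<forall>u v. gc_pairing (J u) (J v) = gc_pairing u v) \<and>
     (\<forall>u v. cotangent_bracket br u v + J (cotangent_bracket br (J u) v)
        + J (cotangent_bracket br u (J v)) - cotangent_bracket br (J u) (J v) = 0)"

definition gc_block2 :: "('a::real_vector \<times> 'a dual \<Rightarrow> 'a \<times> 'a dual) \<Rightarrow> 'a dual \<Rightarrow> 'a" where
  "gc_block2 J \<alpha> = fst (J (0, \<alpha>))"

text \<open>The condition \<open>k \<le> n\<close> rules out truncated subtraction.\<close>

definition gc_type :: "('a::real_vector \<times> 'a dual \<Rightarrow> 'a \<times> 'a dual) \<Rightarrow> nat \<Rightarrow> bool" where
  "gc_type J k \<longleftrightarrow>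
     (\<exists>n. dim (UNIV :: 'a set) = 2 * n \<and> k \<le> n \<and> dim (range (gc_block2 J)) = 2 * (n - k))"

definition admits_gcs_of_type :: "('a::real_vector \<Rightarrow> 'a \<Rightarrow> 'a) \<Rightarrow> nat \<Rightarrow> bool" where
  "admits_gcs_of_type br k \<longleftrightarrow> (\<exists>J. generalized_complex_structure br J \<and> gc_type J k)"

section \<open>The Lie algebra \<open>\<dd>\<^sub>4\<close>\<close>

text \<open>
  The basis vector \<open>e\<^sub>i\<close> is \<open>axis i 1\<close> for \<open>i = 0, 1, 2, 3\<close>; these are the four elements of the
  index type \<open>4\<close>, in which \<open>0 = 4\<close>. The bracket is the bilinear extension of the
  structure equations, which are checked in \<open>d4_bracket_basis\<close>.
\<close>

definition d4_bracket :: "real^4 \<Rightarrow> real^4 \<Rightarrow> real^4" where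
  "d4_bracket x y =
     (x$0 * y$1 - x$1 * y$0) *\<^sub>R axis 1 1
     - (x$0 * y$2 - x$2 * y$0) *\<^sub>R axis 2 1
     + (x$1 * y$2 - x$2 * y$1) *\<^sub>R axis 3 1"

lemma d4_bracket_basis:
  "d4_bracket (axis 0 1) (axis 1 1) = axis 1 1"
  "d4_bracket (axis 0 1) (axis 2 1) = - axis 2 1"
  "d4_bracket (axis 0 1) (axis 3 1) = 0"
  "d4_bracket (axis 1 1) (axis 2 1) = axis 3 1"
  "d4_bracket (axis 1 1) (axis 3 1) = 0"
  "d4_bracket (axis 2 1) (axis 3 1) = 0"
  by (simp_all add: d4_bracket_def axis_def)

lemma lie_algebra_d4: "lie_algebra d4_bracket"
  unfolding lie_algebra_def bilinear_def
  by (auto intro!: linearI simp: d4_bracket_def axis_def vec_eq_iff algebra_simps)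

end

theory Submission
  imports Defs
begin

text \<open>
  Let \<open>\<gg>\<close> be solvable of dimension 4. If \<open>\<gg>' = [\<gg>, \<gg>]\<close> has dimension at most 2, it lies in an abelian
  plane on which \<open>\<gg>\<close> acts by a commuting pencil of matrices: either the pencil is degenerate, and
  \<open>\<gg>\<close> has an abelian ideal of codimension 1, or some exact 2-form \<open>(x, y) \<mapsto> f [x, y]\<close> is symplectic,
  which gives type 0. If \<open>dim \<gg>' = 3\<close>, then \<open>\<gg>'\<close> is abelian or a Heisenberg algebra with centre \<open>z\<close>, and
  in the latter case \<open>\<gg> / \<gg>'\<close> acts on \<open>\<gg>' / z\<close> by an invertible matrix \<open>A\<close>: if \<open>tr A \<noteq> 0\<close> there is an exact
  symplectic form, if \<open>tr A = 0 < det A\<close> there is a structure of type 1, and if \<open>tr A = 0 > det A\<close>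
  the algebra is \<open>\<dd>\<^sub>4\<close>. A structure of type 2 is a complex structure, and a complex structure together
  with an abelian ideal of codimension 1 again produces a structure of type 1.

  For \<open>\<dd>\<^sub>4\<close> itself, \<open>e\<^sub>3\<close> is in the kernel of every closed 2-form, which excludes type 0. For type 1
  the image of \<open>J\<^sub>2\<close> is spanned by \<open>e\<^sub>3\<close> and one of \<open>e\<^sub>1\<close>, \<open>e\<^sub>2\<close>, and integrability contradicts \<open>J\<^sup>2 = -1\<close>.
\<close>

section \<open>Duals and bases\<close>

lemma linear_dual_apply: "linear (dual_apply \<alpha>)"
  using dual_apply[of \<alpha>] by simp

lemma dual_eqI: "(\<And>x. dual_apply \<alpha> x = dual_apply \<beta> x) \<Longrightarrow> \<alpha> = \<beta>"
  by (metis dual_apply_inject ext)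

lemmas dual_apply_linear_simps =
  linear_add[OF linear_dual_apply] linear_diff[OF linear_dual_apply]
  linear_neg[OF linear_dual_apply] linear_cmul[OF linear_dual_apply]
  linear_0[OF linear_dual_apply]

lemmas dual_simps = dual_apply_linear_simps
  zero_dual.rep_eq plus_dual.rep_eq minus_dual.rep_eq uminus_dual.rep_eq scaleR_dual.rep_eq

lemma dual_apply_Abs: "linear f \<Longrightarrow> dual_apply (Abs_dual f) = f"
  by (simp add: Abs_dual_inverse)

text \<open>An infinite basis has \<open>card\<close> 0, so \<open>dim\<close> is 0 on an
  infinite-dimensional space. A positive dimension therefore forces bases to be finite.\<close>

lemma finite_dim_basis:
  assumes "0 < dim (UNIV :: 'a::real_vector set)"
  obtains C :: "'a::real_vector set" where "finite C" "independent C" "span C = UNIV"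
    "card C = dim (UNIV :: 'a::real_vector set)"
proof -
  obtain C :: "'a set" where C: "independent C" "UNIV \<subseteq> span C" "card C = dim (UNIV :: 'a set)"
    by (rule basis_exists[of UNIV])
  then show thesis
    using assms by (intro that[of C] card_ge_0_finite) auto
qed

section \<open>Frames of a four-dimensional space\<close>

text \<open>Coefficients of an ordered quadruple exclude repeated vectors, which the set
  \<open>{a, b, c, d}\<close> would silently merge.\<close>

definition frame :: "'a::real_vector \<Rightarrow> 'a \<Rightarrow> 'a \<Rightarrow> 'a \<Rightarrow> bool" where
  "frame a b c d \<longleftrightarrow>
    (\<forall>s t u v. s *\<^sub>R a + t *\<^sub>R b + u *\<^sub>R c + v *\<^sub>R d = 0 \<longrightarrow> s = 0 \<and> t = 0 \<and> u = 0 \<and> v = 0)"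

lemma frameD:
  "frame a b c d \<Longrightarrow> s *\<^sub>R a + t *\<^sub>R b + u *\<^sub>R c + v *\<^sub>R d = 0 \<Longrightarrow>
    s = 0 \<and> t = 0 \<and> u = 0 \<and> v = 0"
  unfolding frame_def by blast

lemma frame_rotate:
  assumes "frame a b c d"
  shows "frame b c d a"
  unfolding frame_def
proof (intro allI impI)
  fix s t u v
  assume "s *\<^sub>R b + t *\<^sub>R c + u *\<^sub>R d + v *\<^sub>R a = 0"
  then have "v *\<^sub>R a + s *\<^sub>R b + t *\<^sub>R c + u *\<^sub>R d = 0"
    by (simp add: algebra_simps)
  from frameD[OF assms this] show "s = 0 \<and> t = 0 \<and> u = 0 \<and> v = 0"
    by simp
qed

lemma frame_not_in_span:
  assumes "frame a b c d"
  shows "a \<notin> span {b, c, d}"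
proof
  assume "a \<in> span {b, c, d}"
  then obtain k l m where "a - k *\<^sub>R b - l *\<^sub>R c - m *\<^sub>R d = 0"
    by (auto simp: span_breakdown_eq)
  then have "1 *\<^sub>R a + (- k) *\<^sub>R b + (- l) *\<^sub>R c + (- m) *\<^sub>R d = 0"
    by simp
  from frameD[OF assms this] show False
    by simp
qed

lemma frame_independent:
  assumes "frame a b c d"
  shows "independent {a, b, c, d}" "card {a, b, c, d} = 4"
proof -
  note f1 = frame_not_in_span[OF assms]
  note r2 = frame_rotate[OF assms]
  note r3 = frame_rotate[OF r2]
  note r4 = frame_rotate[OF r3]
  have f2: "b \<notin> span {c, d}"
    using frame_not_in_span[OF r2] span_mono[of "{c, d}" "{c, d, a}"] by auto
  have f3: "c \<notin> span {d}"
    using frame_not_in_span[OF r3] span_mono[of "{d}" "{d, a, b}"] by auto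
  have f4: "d \<notin> span {}"
    using frame_not_in_span[OF r4] span_mono[of "{}" "{a, b, c}"] by auto
  have "a \<notin> {b, c, d}" "b \<notin> {c, d}" "c \<notin> {d}"
    using f1 f2 f3 by (auto simp: span_base)
  then show "card {a, b, c, d} = 4"
    by simp
  show "independent {a, b, c, d}"
    by (intro independent_insertI f1 f2 f3 f4 independent_empty)
qed

text \<open>A vector outside the span could be adjoined, giving an independent set larger than a
  finite spanning set.\<close>

lemma independent_card_spans:
  fixes S :: "'a::real_vector set"
  assumes "0 < dim (UNIV :: 'a set)" "independent S" "card S = dim (UNIV :: 'a set)"
  shows "span S = UNIV"
proof (rule ccontr)
  assume "span S \<noteq> UNIV"
  then obtain x where x: "x \<notin> span S"
    by blast
  then have "x \<notin> S"
    by (metis span_base)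
  have "independent (insert x S)"
    using x assms(2) by (rule independent_insertI)
  obtain C :: "'a set" where C: "finite C" "span C = UNIV" "card C = dim (UNIV :: 'a set)"
    using finite_dim_basis assms(1) by metis
  have "card (insert x S) \<le> card C"
    using independent_span_bound[OF C(1) \<open>independent (insert x S)\<close>] C(2) by simp
  moreover have "finite S"
    using assms by (intro card_ge_0_finite) simp
  ultimately show False
    using \<open>x \<notin> S\<close> C(3) assms(3) by simp
qed

lemma independent_indicator_dual:
  assumes "independent S"
  obtains A where "\<And>x. x \<in> S \<Longrightarrow> dual_apply A x = (if x = a then 1 else 0)"
proof -
  obtain g :: "'a \<Rightarrow> real" where "linear g" "\<forall>x\<in>S. g x = (if x = a then 1 else 0)"
    using linear_independent_extend[OF assms, of "\<lambda>x. if x = a then 1 else 0"] by blast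
  then show thesis
    by (intro that[of "Abs_dual g"]) (simp add: dual_apply_Abs)
qed

text \<open>This is the dual basis. With all sixteen values at hand, later tensor identities become
  polynomial identities in coordinates.\<close>

lemma frame_coords:
  fixes a b c d :: "'a::real_vector"
  assumes dim: "dim (UNIV :: 'a set) = 4" and frame: "frame a b c d"
  obtains A B C D where
    "dual_apply A a = 1" "dual_apply A b = 0" "dual_apply A c = 0" "dual_apply A d = 0"
    "dual_apply B a = 0" "dual_apply B b = 1" "dual_apply B c = 0" "dual_apply B d = 0"
    "dual_apply C a = 0" "dual_apply C b = 0" "dual_apply C c = 1" "dual_apply C d = 0"
    "dual_apply D a = 0" "dual_apply D b = 0" "dual_apply D c = 0" "dual_apply D d = 1"
    "\<And>x. x = dual_apply A x *\<^sub>R a + dual_apply B x *\<^sub>R b + dual_apply C x *\<^sub>R c + dual_apply D x *\<^sub>R d"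
proof -
  note ind = frame_independent(1)[OF frame]
  have ne: "a \<noteq> b" "a \<noteq> c" "a \<noteq> d" "b \<noteq> c" "b \<noteq> d" "c \<noteq> d"
    using frame_independent(2)[OF frame] by (auto simp: card_insert_if split: if_splits)
  obtain A where A: "\<And>x. x \<in> {a, b, c, d} \<Longrightarrow> dual_apply A x = (if x = a then 1 else 0)"
    using independent_indicator_dual[OF ind, of a] by blast
  obtain B where B: "\<And>x. x \<in> {a, b, c, d} \<Longrightarrow> dual_apply B x = (if x = b then 1 else 0)"
    using independent_indicator_dual[OF ind, of b] by blast
  obtain C where C: "\<And>x. x \<in> {a, b, c, d} \<Longrightarrow> dual_apply C x = (if x = c then 1 else 0)"
    using independent_indicator_dual[OF ind, of c] by blast
  obtain D where D: "\<And>x. x \<in> {a, b, c, d} \<Longrightarrow> dual_apply D x = (if x = d then 1 else 0)"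
    using independent_indicator_dual[OF ind, of d] by blast
  note vals = A[of a] A[of b] A[of c] A[of d] B[of a] B[of b] B[of c] B[of d]
    C[of a] C[of b] C[of c] C[of d] D[of a] D[of b] D[of c] D[of d]
  have vals': "dual_apply A a = 1" "dual_apply A b = 0" "dual_apply A c = 0" "dual_apply A d = 0"
    "dual_apply B a = 0" "dual_apply B b = 1" "dual_apply B c = 0" "dual_apply B d = 0"
    "dual_apply C a = 0" "dual_apply C b = 0" "dual_apply C c = 1" "dual_apply C d = 0"
    "dual_apply D a = 0" "dual_apply D b = 0" "dual_apply D c = 0" "dual_apply D d = 1"
    using vals ne by simp_all
  moreover have "x = dual_apply A x *\<^sub>R a + dual_apply B x *\<^sub>R b + dual_apply C x *\<^sub>R c
    + dual_apply D x *\<^sub>R d" for x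
  proof -
    have "x \<in> span {a, b, c, d}"
      using independent_card_spans[OF _ ind] frame_independent(2)[OF frame] dim by simp
    then obtain s t u v where "x - s *\<^sub>R a - t *\<^sub>R b - u *\<^sub>R c - v *\<^sub>R d = 0"
      by (auto simp: span_breakdown_eq)
    then have x: "x = s *\<^sub>R a + t *\<^sub>R b + u *\<^sub>R c + v *\<^sub>R d"
      by (simp add: algebra_simps)
    show ?thesis
      by (subst (2 3 4 5) x) (simp add: dual_apply_linear_simps vals', rule x)
  qed
  ultimately show thesis
    by (rule that)
qed

lemma scaleR_add_eq_0_not_in_span:
  assumes "v \<notin> span S" "w \<in> span S" "c *\<^sub>R v + w = 0"
  shows "c = 0"
proof (rule ccontr)
  assume "c \<noteq> 0"
  have "c *\<^sub>R v = - w"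
    using assms(3) by (simp add: eq_neg_iff_add_eq_0)
  then have "v = (1 / c) *\<^sub>R (- w)"
    using \<open>c \<noteq> 0\<close> by (metis divide_inverse_commute mult.right_neutral right_inverse scaleR_one scaleR_scaleR
        mult.commute)
  then show False
    using assms(1,2) span_scale span_neg by metis
qed

lemma frame_of_not_in_span:
  assumes "p \<noteq> 0" "q \<notin> span {p}" "r \<notin> span {p, q}" "x \<notin> span {p, q, r}"
  shows "frame x p q r"
  unfolding frame_def
proof (intro allI impI)
  fix s t u v
  assume z: "s *\<^sub>R x + t *\<^sub>R p + u *\<^sub>R q + v *\<^sub>R r = 0"
  have "t *\<^sub>R p + u *\<^sub>R q + v *\<^sub>R r \<in> span {p, q, r}" "u *\<^sub>R q + t *\<^sub>R p \<in> span {p, q}"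
    "t *\<^sub>R p \<in> span {p}"
    by (simp_all add: span_add span_mul span_base)
  note in_span = this
  have s: "s = 0"
    using scaleR_add_eq_0_not_in_span[OF assms(4) in_span(1)] z by (simp add: algebra_simps)
  have v: "v = 0"
    using scaleR_add_eq_0_not_in_span[OF assms(3) in_span(2)] z s by (simp add: algebra_simps)
  have u: "u = 0"
    using scaleR_add_eq_0_not_in_span[OF assms(2) in_span(3)] z s v by (simp add: algebra_simps)
  show "s = 0 \<and> t = 0 \<and> u = 0 \<and> v = 0"
    using s v u z assms(1) by simp
qed

lemma exists_not_in_span:
  fixes S :: "'a::real_vector set"
  assumes "finite S" "card S < dim (UNIV :: 'a set)"
  shows "\<exists>x. x \<notin> span S"
proof (rule ccontr)
  assume "\<nexists>x. x \<notin> span S"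
  then have "span S = UNIV"
    by auto
  obtain C :: "'a set" where C: "independent C" "card C = dim (UNIV :: 'a set)"
    using finite_dim_basis assms(2) by (metis gr_implies_not0 gr0I)
  have "card C \<le> card S"
    using independent_span_bound[OF assms(1) C(1)] \<open>span S = UNIV\<close> by simp
  then show False
    using C(2) assms(2) by simp
qed

lemma exists_frame_extending:
  fixes u v :: "'a::real_vector"
  assumes dim: "dim (UNIV :: 'a set) = 4" and "u \<noteq> 0" "v \<notin> span {u}"
  obtains x y where "frame x u v y"
proof -
  have "card {u, v} < 4"
    by (rule le_less_trans[OF card_insert_le_m1]) auto
  then obtain y where y: "y \<notin> span {u, v}"
    using exists_not_in_span[of "{u, v}"] dim by auto
  have "card {u, v, y} < 4"
    using card_length[of "[u, v, y]"] by simp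
  then obtain x where "x \<notin> span {u, v, y}"
    using exists_not_in_span[of "{u, v, y}"] dim by auto
  then show thesis
    using frame_of_not_in_span[OF assms(2,3) y] that by blast
qed

section \<open>Planes, pencils of 2 x 2 matrices and orthogonal complements\<close>

lemma span_pairE:
  assumes "x \<in> span {u, v}"
  obtains k l where "x = k *\<^sub>R u + l *\<^sub>R v"
proof -
  obtain k l where "x - k *\<^sub>R u - l *\<^sub>R v = 0"
    using assms by (auto simp: span_breakdown_eq)
  then show thesis
    by (intro that[of k l]) (simp add: algebra_simps)
qed

text \<open>For matrices A and B with entries a and b, \<open>comm\<close> is AB = BA and
  \<open>det\<close> says that every row vector (s, t) has parallel images under A and B. Together
  these kill all six 2 x 2 minors of the 2 x 4 matrix with rows A and B: \<open>m1\<close> to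
  \<open>m5\<close> and \<open>comm(1)\<close>. So A and B are proportional, and any nonzero entry
  of A supplies the coefficients.\<close>

lemma commuting_pencil_dependent:
  fixes a11 a12 a21 a22 b11 b12 b21 b22 :: real
  assumes comm: "a12 * b21 = b12 * a21" "a11 * b12 + a12 * b22 = b11 * a12 + b12 * a22"
      "a21 * b11 + a22 * b21 = b21 * a11 + b22 * a21"
    and det: "\<And>s t. (s * a11 + t * a21) * (s * b12 + t * b22) = (s * a12 + t * a22) * (s * b11 + t * b21)"
  obtains \<alpha> \<beta> where "\<alpha> \<noteq> 0 \<or> \<beta> \<noteq> 0" "\<alpha> * a11 + \<beta> * b11 = 0" "\<alpha> * a12 + \<beta> * b12 = 0"
    "\<alpha> * a21 + \<beta> * b21 = 0" "\<alpha> * a22 + \<beta> * b22 = 0"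
proof -
  have m1: "a11 * b12 = a12 * b11"
    using det[of 1 0] by simp
  have m2: "a21 * b22 = a22 * b21"
    using det[of 0 1] by simp
  have m3: "a12 * b22 = a22 * b12"
    using comm(2) m1 by (simp add: algebra_simps)
  have m4: "a11 * b21 = a21 * b11"
    using comm(3) m2 by (simp add: algebra_simps)
  have m5: "a11 * b22 = a22 * b11"
    using det[of 1 1] m1 m2 comm(1) by (simp add: algebra_simps)
  consider "a11 \<noteq> 0" | "a12 \<noteq> 0" | "a21 \<noteq> 0" | "a22 \<noteq> 0"
    | "a11 = 0" "a12 = 0" "a21 = 0" "a22 = 0"
    by blast
  then show thesis
  proof cases
    case 1
    then show thesis
      using m1 m4 m5 by (intro that[of b11 "- a11"]) (simp_all add: algebra_simps)
  next
    case 2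
    then show thesis
      using m1 m3 comm(1) by (intro that[of b12 "- a12"]) (simp_all add: algebra_simps)
  next
    case 3
    then show thesis
      using m2 m4 comm(1) by (intro that[of b21 "- a21"]) (simp_all add: algebra_simps)
  next
    case 4
    then show thesis
      using m2 m3 m5 by (intro that[of b22 "- a22"]) (simp_all add: algebra_simps)
  next
    case 5
    then show thesis
      by (intro that[of 1 0]) simp_all
  qed
qed

lemma in_span_singleton: "x \<in> span {p} \<Longrightarrow> \<exists>k. x = k *\<^sub>R p"
  by (auto simp: span_singleton)

lemma subspace_coeff_eq_0:
  assumes "subspace S" "y \<notin> S" "w \<in> S" "k *\<^sub>R y + w \<in> S"
  shows "k = 0"
proof (rule ccontr)
  assume "k \<noteq> 0"
  have "(1 / k) *\<^sub>R ((k *\<^sub>R y + w) - w) \<in> S"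
    using assms by (intro subspace_scale subspace_diff)
  then show False
    using \<open>k \<noteq> 0\<close> assms(2) by simp
qed

text \<open>A nonzero column, rotated by a right angle, is a left null vector. It serves below as a
  functional that kills brackets.\<close>

lemma singular_left_kernel:
  fixes a b c d :: real
  assumes "a * d - b * c = 0"
  obtains l1 l2 where "l1 \<noteq> 0 \<or> l2 \<noteq> 0" "l1 * a + l2 * c = 0" "l1 * b + l2 * d = 0"
proof -
  consider "c \<noteq> 0 \<or> a \<noteq> 0" | "a = 0" "c = 0" "d \<noteq> 0 \<or> b \<noteq> 0" | "a = 0" "b = 0" "c = 0" "d = 0"
    by blast
  then show thesis
  proof cases
    case 1
    then show thesis
      using assms by (intro that[of c "- a"]) (auto simp: algebra_simps)
  next
    case 2
    then show thesis
      by (intro that[of d "- b"]) auto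
  next
    case 3
    then show thesis
      by (intro that[of 1 0]) simp_all
  qed
qed

lemma subspace_orthogonal_dim:
  assumes "subspace (S :: 'a::euclidean_space set)"
  shows "subspace {y. \<forall>x\<in>S. orthogonal x y}" "dim {y. \<forall>x\<in>S. orthogonal x y} + dim S = DIM('a)"
  using dim_subspace_orthogonal_to_vectors[OF assms subspace_UNIV] subspace_orthogonal_to_vectors[of S]
  by simp_all

section \<open>Complex and symplectic structures\<close>

context
  fixes br :: "'a::real_vector \<Rightarrow> 'a \<Rightarrow> 'a"
  assumes lie: "lie_algebra br"
begin

lemma lie_linear_right: "linear (br x)"
  using lie by (simp add: lie_algebra_def bilinear_def)

lemma lie_linear_left: "linear (\<lambda>x. br x y)"
  using lie by (simp add: lie_algebra_def bilinear_def)

lemmas lie_linear_simps =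
  linear_add[OF lie_linear_right] linear_diff[OF lie_linear_right]
  linear_neg[OF lie_linear_right] linear_cmul[OF lie_linear_right]
  linear_0[OF lie_linear_right]
  linear_add[OF lie_linear_left] linear_diff[OF lie_linear_left]
  linear_neg[OF lie_linear_left] linear_cmul[OF lie_linear_left]
  linear_0[OF lie_linear_left]

lemma lie_alt: "br x x = 0"
  using lie by (simp add: lie_algebra_def)

lemma lie_skew: "br y x = - br x y"
proof -
  have "br (x + y) (x + y) = 0"
    by (rule lie_alt)
  then have "br y x + br x y = 0"
    unfolding lie_linear_simps by (simp add: lie_alt add.commute)
  then show ?thesis
    by (rule eq_neg_iff_add_eq_0[THEN iffD2])
qed

lemma lie_jacobi: "br x (br y z) = br (br x y) z + br y (br x z)"
proof -
  have "br x (br y z) + br y (br z x) + br z (br x y) = 0"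
    using lie by (simp add: lie_algebra_def)
  moreover have "br y (br z x) = - br y (br x z)" "br z (br x y) = - br (br x y) z"
    by (simp_all add: lie_skew[of z x] lie_skew[of z "br x y"] lie_linear_simps)
  ultimately show ?thesis
    by (simp add: algebra_simps eq_neg_iff_add_eq_0)
qed

lemma fst_cotangent_bracket: "fst (cotangent_bracket br u v) = br (fst u) (fst v)"
  by (simp add: cotangent_bracket_def)

lemma snd_cotangent_bracket:
  "dual_apply (snd (cotangent_bracket br u v)) z =
    - dual_apply (snd v) (br (fst u) z) + dual_apply (snd u) (br (fst v) z)"
  using dual_apply_snd_cotangent_bracket[OF lie, of "fst u" "snd u" "fst v" "snd v"] by simp

text \<open>The structure is diagonal: \<open>j\<close> on vectors and minus its transpose on
  functionals. With T the left-hand side of \<open>N\<close>, the functional part of the torsion at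
  z is - (snd v) (T (fst u) z) + (snd u) (T (fst v) z).\<close>

lemma gcs_of_complex_structure:
  assumes dim: "dim (UNIV :: 'a set) = 2 * n"
    and j: "linear j" "\<And>x. j (j x) = - x"
    and N: "\<And>x y. br x y + j (br (j x) y) + j (br x (j y)) - br (j x) (j y) = 0"
  shows "admits_gcs_of_type br n"
proof -
  define jt where "jt \<alpha> = Abs_dual (\<lambda>x. - dual_apply \<alpha> (j x))" for \<alpha>
  define J where "J u = (j (fst u), jt (snd u))" for u
  have jt: "dual_apply (jt \<alpha>) x = - dual_apply \<alpha> (j x)" for \<alpha> x
    unfolding jt_def
    by (subst dual_apply_Abs)
      (auto intro!: linear_compose_neg linear_compose[OF j(1) linear_dual_apply, unfolded o_def])
  note js = linear_add[OF j(1)] linear_cmul[OF j(1)] linear_neg[OF j(1)] linear_diff[OF j(1)]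
  have "linear J"
    by (rule linearI) (auto simp: J_def js jt dual_simps intro!: dual_eqI)
  moreover have "J (J u) = - u" for u
    by (auto simp: J_def j jt dual_simps prod_eq_iff intro!: dual_eqI)
  moreover have "gc_pairing (J u) (J v) = gc_pairing u v" for u v
    by (simp add: gc_pairing_def J_def jt j dual_simps)
  moreover have "cotangent_bracket br u v + J (cotangent_bracket br (J u) v)
      + J (cotangent_bracket br u (J v)) - cotangent_bracket br (J u) (J v) = 0" for u v
  proof (rule prod_eqI)
    show "snd (cotangent_bracket br u v + J (cotangent_bracket br (J u) v)
      + J (cotangent_bracket br u (J v)) - cotangent_bracket br (J u) (J v)) = snd 0"
    proof (rule dual_eqI)
      fix z
      have "dual_apply (snd v) (br (fst u) z + j (br (j (fst u)) z) + j (br (fst u) (j z))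
          - br (j (fst u)) (j z)) = 0"
        "dual_apply (snd u) (br (fst v) z + j (br (j (fst v)) z) + j (br (fst v) (j z))
          - br (j (fst v)) (j z)) = 0"
        by (simp_all only: N dual_simps)
      then show "dual_apply (snd (cotangent_bracket br u v + J (cotangent_bracket br (J u) v)
      + J (cotangent_bracket br u (J v)) - cotangent_bracket br (J u) (J v))) z
        = dual_apply (snd 0) z"
        by (simp add: dual_simps snd_cotangent_bracket J_def jt)
    qed
  qed (simp add: fst_cotangent_bracket J_def N)
  ultimately have "generalized_complex_structure br J"
    by (simp add: generalized_complex_structure_def)
  moreover have "gc_block2 J = (\<lambda>\<alpha>. 0)"
    by (auto simp: gc_block2_def J_def linear_0[OF j(1)])
  then have "range (gc_block2 J) = {0}"
    by auto
  then have "dim (range (gc_block2 J)) = 0"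
    by (intro dim_unique[of "{}"]) (simp_all add: independent_empty)
  then have "gc_type J n"
    unfolding gc_type_def using dim by (intro exI[of _ n]) simp
  ultimately show ?thesis
    unfolding admits_gcs_of_type_def by blast
qed

text \<open>Type n means rank 0, so \<open>gc_block2 J\<close> vanishes. Then the vector part of
  \<open>J u\<close> depends on the vector part of \<open>u\<close> only, and the upper left block
  inherits both equations from \<open>J\<close>.\<close>

lemma complex_structure_of_gcs:
  assumes "dim (UNIV :: 'a set) = 2 * n" "0 < n" "admits_gcs_of_type br n"
  obtains j where "linear j" "\<And>x. j (j x) = - x"
    "\<And>x y. br x y + j (br (j x) y) + j (br x (j y)) - br (j x) (j y) = 0"
proof -
  obtain J where J: "generalized_complex_structure br J" and type: "gc_type J n"
    using assms(3) by (auto simp: admits_gcs_of_type_def)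
  have lin: "linear J" and sq: "\<And>u. J (J u) = - u"
    and N: "\<And>u v. cotangent_bracket br u v + J (cotangent_bracket br (J u) v)
        + J (cotangent_bracket br u (J v)) - cotangent_bracket br (J u) (J v) = 0"
    using J unfolding generalized_complex_structure_def by blast+
  \<comment> \<open>\<open>dim\<close> is also 0 for infinite-dimensional subspaces, so a basis of
    the range is first shown to be finite and only then to be empty.\<close>
  obtain B where B: "B \<subseteq> range (gc_block2 J)" "independent B"
    "range (gc_block2 J) \<subseteq> span B" "card B = dim (range (gc_block2 J))"
    by (rule basis_exists)
  obtain C :: "'a set" where C: "finite C" "span C = UNIV"
    using finite_dim_basis assms(1,2) by (metis nat_0_less_mult_iff zero_less_numeral)
  then have "finite B"
    using independent_span_bound[OF C(1) B(2)] C(2) by simp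
  moreover have "card B = 0"
    using type assms(1) B(4) by (auto simp: gc_type_def)
  ultimately have "range (gc_block2 J) \<subseteq> {0}"
    using B(3) by simp
  then have block: "fst (J (0, \<alpha>)) = 0" for \<alpha>
    unfolding gc_block2_def by auto
  have fstJ: "fst (J u) = fst (J (fst u, 0))" for u
  proof -
    have "J u = J ((fst u, 0) + (0, snd u))"
      by simp
    also have "\<dots> = J (fst u, 0) + J (0, snd u)"
      using linear_add[OF lin] by blast
    finally show ?thesis
      by (simp add: block)
  qed
  define j where "j x = fst (J (x, 0))" for x
  show thesis
  proof
    show "linear j"
      using linear_compose[OF linear_compose[OF _ lin] linear_fst, of "\<lambda>x. (x, 0)"]
      by (simp add: j_def[abs_def] o_def linear_iff)
    show "j (j x) = - x" for x
      using fstJ[of "J (x, 0)"] by (simp add: j_def sq)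
    show "br x y + j (br (j x) y) + j (br x (j y)) - br (j x) (j y) = 0" for x y
      using arg_cong[OF N[of "(x, 0)" "(y, 0)"], of fst]
      by (simp add: fst_cotangent_bracket fstJ[of "cotangent_bracket _ _ _"] j_def)
  qed
qed

text \<open>The symplectic form is the exact form \<open>(x, y) \<mapsto> f [x, y]\<close>, closed by the Jacobi identity.\<close>

lemma gcs_of_frobenius:
  assumes dim: "dim (UNIV :: 'a set) = 2 * n" "0 < n"
    and f: "linear (f :: 'a \<Rightarrow> real)"
    and nondeg: "\<And>x. (\<And>y. f (br x y) = 0) \<Longrightarrow> x = 0"
  shows "admits_gcs_of_type br 0"
proof -
  note fs = linear_add[OF f] linear_diff[OF f] linear_neg[OF f] linear_cmul[OF f] linear_0[OF f]
  define W where "W x = Abs_dual (\<lambda>y. f (br x y))" for x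
  have W: "dual_apply (W x) y = f (br x y)" for x y
    unfolding W_def
    by (subst dual_apply_Abs)
      (auto intro: linear_compose[OF lie_linear_right f, unfolded o_def])
  have linW: "linear W"
    by (rule linearI) (auto simp: W dual_simps lie_linear_simps fs intro!: dual_eqI)
  have injW: "W x = 0 \<Longrightarrow> x = 0" for x
    by (rule nondeg) (simp flip: W add: zero_dual.rep_eq)
  obtain C :: "'a set" where C: "finite C" "independent C" "span C = UNIV"
    "card C = dim (UNIV :: 'a set)"
    using finite_dim_basis dim by (metis nat_0_less_mult_iff zero_less_numeral)
  \<comment> \<open>\<open>T\<close> embeds the dual into the space through the basis
    \<open>C\<close>. It turns injectivity of \<open>W\<close> into surjectivity by counting
    dimensions inside one space.\<close>
  define T where "T \<alpha> = (\<Sum>c\<in>C. dual_apply \<alpha> c *\<^sub>R c)" for \<alpha> :: "'a dual"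
  have linT: "linear T"
    by (rule linearI) (auto simp: T_def dual_simps sum.distrib scaleR_add_left scaleR_sum_right)
  have injT: "\<alpha> = 0" if "T \<alpha> = 0" for \<alpha>
  proof (rule dual_eqI)
    fix x
    have "dual_apply \<alpha> c = 0" if "c \<in> C" for c
      using independentD[OF C(2) C(1) subset_refl, of "dual_apply \<alpha>" c] \<open>T \<alpha> = 0\<close> that
      by (simp add: T_def)
    then show "dual_apply \<alpha> x = dual_apply 0 x"
      using linear_eq_0_on_span[OF linear_dual_apply, of C \<alpha> x] C(3) by (simp add: dual_simps)
  qed
  have linTW: "linear (\<lambda>x. T (W x))"
    using linear_compose[OF linW linT] by (simp add: o_def)
  have injTW: "inj (\<lambda>x. T (W x))"
    unfolding linear_injective_0[OF linTW] using injW injT by simp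
  have "span ((\<lambda>x. T (W x)) ` C) = UNIV"
  proof (rule independent_card_spans)
    show "independent ((\<lambda>x. T (W x)) ` C)"
      using linear_independent_injective_image[OF linTW C(2)] injTW by (simp add: inj_on_subset)
    show "card ((\<lambda>x. T (W x)) ` C) = dim (UNIV :: 'a set)"
      using card_image[of "\<lambda>x. T (W x)" C] injTW C(4) by (simp add: inj_on_subset)
  qed (use dim in simp)
  then have "range (\<lambda>x. T (W x)) = UNIV"
    using linear_span_image[OF linTW, of C] C(3) by simp
  then have "\<exists>x. T (W x) = T \<alpha>" for \<alpha>
    by (metis rangeE UNIV_I)
  then have "\<exists>x. W x = \<alpha>" for \<alpha>
    using injT linear_diff[OF linT] by (metis eq_iff_diff_eq_0)
  then obtain V where V: "\<And>\<alpha>. W (V \<alpha>) = \<alpha>"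
    by metis
  have V_W: "V (W x) = x" for x
    using V[of "W x"] injW[of "V (W x) - x"] by (simp add: linear_diff[OF linW])
  have linV: "linear V"
    by (rule linearI) (metis V V_W linear_add[OF linW], metis V V_W linear_cmul[OF linW])
  note Vs = linear_add[OF linV] linear_diff[OF linV] linear_neg[OF linV] linear_cmul[OF linV]
  note Ws = linear_add[OF linW] linear_diff[OF linW] linear_neg[OF linW] linear_cmul[OF linW]
  have alpha: "dual_apply \<alpha> x = f (br (V \<alpha>) x)" for \<alpha> x
    by (metis V W)
  \<comment> \<open>The usual structure of a symplectic form: the form \<open>W\<close> below the
    diagonal and minus its inverse \<open>V\<close> above.\<close>
  define J where "J u = (- V (snd u), W (fst u))" for u
  have fst_J: "fst (J u) = - V (snd u)" and snd_J: "snd (J u) = W (fst u)" for u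
    by (simp_all add: J_def)
  have "linear J"
    by (rule linearI) (auto simp: J_def Ws Vs)
  moreover have "J (J u) = - u" for u
    by (auto simp: J_def Ws Vs V V_W prod_eq_iff)
  moreover have "gc_pairing (J u) (J v) = gc_pairing u v" for u v
    by (simp add: gc_pairing_def fst_J snd_J W alpha[of "snd u"] alpha[of "snd v"] V lie_linear_simps fs
        lie_skew[of "fst u" "V (snd v)"] lie_skew[of "fst v" "V (snd u)"])
  moreover have "cotangent_bracket br u v + J (cotangent_bracket br (J u) v)
      + J (cotangent_bracket br u (J v)) - cotangent_bracket br (J u) (J v) = 0" for u v
  proof -
    let ?N = "cotangent_bracket br u v + J (cotangent_bracket br (J u) v)
      + J (cotangent_bracket br u (J v)) - cotangent_bracket br (J u) (J v)"
    note cb = fst_cotangent_bracket snd_cotangent_bracket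
    note a = alpha[of "snd u"] alpha[of "snd v"]
    \<comment> \<open>This is closedness of the form. As \<open>W\<close> is injective, the vector
      part of the torsion can be tested after applying \<open>W\<close>.\<close>
    have jac: "f (br x (br y z)) = f (br (br x y) z) + f (br y (br x z))" for x y z
      using lie_jacobi[of x y z] by (simp add: fs)
    have "dual_apply (W (fst ?N)) z = 0" for z
      using jac[of "fst u" "fst v" z] jac[of "V (snd u)" "V (snd v)" z]
      by (simp add: cb fst_J snd_J Ws V V_W dual_simps W a lie_linear_simps fs)
    then have "fst ?N = 0"
      by (intro injW dual_eqI) (simp add: dual_simps)
    moreover have "snd ?N = 0"
    proof (rule dual_eqI)
      fix z
      show "dual_apply (snd ?N) z = dual_apply 0 z"
        using jac[of "fst u" "V (snd v)" z] jac[of "V (snd u)" "fst v" z]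
        by (simp add: cb fst_J snd_J Ws V V_W dual_simps W a lie_linear_simps fs)
    qed
    ultimately show ?thesis
      by (simp add: prod_eq_iff)
  qed
  ultimately have "generalized_complex_structure br J"
    by (simp add: generalized_complex_structure_def)
  moreover have "gc_block2 J = (\<lambda>\<alpha>. - V \<alpha>)"
    by (auto simp: gc_block2_def fst_J)
  then have "range (gc_block2 J) = UNIV"
    by (intro surjI[of _ "\<lambda>x. - W x"]) (simp add: Vs V_W)
  then have "gc_type J 0"
    unfolding gc_type_def using dim by (intro exI[of _ n]) simp
  ultimately show ?thesis
    unfolding admits_gcs_of_type_def by blast
qed

end

section \<open>Solvable Lie algebras\<close>

lemma derived_subspace_mono: "S \<subseteq> T \<Longrightarrow> derived_subspace br S \<subseteq> derived_subspace br T"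
  unfolding derived_subspace_def by (rule span_mono) auto

lemma br_in_derived_subspace: "x \<in> S \<Longrightarrow> y \<in> S \<Longrightarrow> br x y \<in> derived_subspace br S"
  unfolding derived_subspace_def by (rule span_base) auto

lemma subspace_derived_subspace: "subspace (derived_subspace br S)"
  unfolding derived_subspace_def by (rule subspace_span)

lemma derived_subspace_linear_eq_0:
  assumes "linear f" "\<And>x y. x \<in> S \<Longrightarrow> y \<in> S \<Longrightarrow> f (br x y) = 0" "w \<in> derived_subspace br S"
  shows "f w = 0"
  by (rule linear_eq_0_on_span[OF assms(1)]) (use assms(2,3) in \<open>auto simp: derived_subspace_def\<close>)

text \<open>Such a set survives in every term of the derived series. This makes the derived algebra
  proper, and likewise its own derived algebra.\<close>

lemma lie_solvable_perfect:
  assumes "lie_solvable br" "S \<subseteq> derived_subspace br S"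
  shows "S \<subseteq> {0}"
proof -
  have "S \<subseteq> (derived_subspace br ^^ m) UNIV" for m
  proof (induction m)
    case (Suc m)
    then show ?case
      using subset_trans[OF assms(2) derived_subspace_mono] by simp
  qed simp
  then show ?thesis
    using assms(1) unfolding lie_solvable_def by metis
qed

context
  fixes br :: "'a::real_vector \<Rightarrow> 'a \<Rightarrow> 'a"
  assumes lie: "lie_algebra br"
begin

text \<open>The action on a one-dimensional ideal is a character, so commutators act trivially.\<close>

lemma derived_centralizes_line:
  assumes ideal: "\<And>x. br x z \<in> span {z}" and w: "w \<in> derived_subspace br UNIV"
  shows "br w z = 0"
proof (rule derived_subspace_linear_eq_0[OF _ _ w])
  show "linear (\<lambda>w. br w z)"
    by (rule lie_linear_left[OF lie])
  fix x y
  obtain k l where k: "br x z = k *\<^sub>R z" and l: "br y z = l *\<^sub>R z"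
    using ideal[of x] ideal[of y] by (auto simp: span_singleton)
  show "br (br x y) z = 0"
    using lie_jacobi[OF lie, of x y z] by (simp add: k l lie_linear_simps[OF lie] mult.commute)
qed

text \<open>Every \<open>ad x\<close> multiplies n = [u, v] by the trace of its action on u and v,
  so n spans an ideal, which u and v centralize as members of the derived algebra. Writing n = k u +
  l v gives [u, n] = l n and [v, n] = - k n, hence n = 0.\<close>

lemma ideal_plane_abelian:
  assumes S: "S \<subseteq> derived_subspace br UNIV" "S \<subseteq> span {u, v}" "u \<in> S" "v \<in> S"
    and ideal: "\<And>x s. s \<in> S \<Longrightarrow> br x s \<in> S"
  shows "br u v = 0"
proof -
  define n where "n = br u v"
  have coeffs: "\<exists>k l. s = k *\<^sub>R u + l *\<^sub>R v" if "s \<in> S" for s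
  proof -
    have "s \<in> span {u, v}"
      using that S(2) by auto
    then obtain k l where "s - k *\<^sub>R u - l *\<^sub>R v = 0"
      by (auto simp: span_breakdown_eq)
    then have "s = k *\<^sub>R u + l *\<^sub>R v"
      by (simp add: algebra_simps)
    then show ?thesis
      by blast
  qed
  note skew = lie_skew[OF lie, of v u]
  have "br x n \<in> span {n}" for x
  proof -
    obtain k l k' l' where kl: "br x u = k *\<^sub>R u + l *\<^sub>R v" "br x v = k' *\<^sub>R u + l' *\<^sub>R v"
      using coeffs[OF ideal[OF S(3)]] coeffs[OF ideal[OF S(4)]] by metis
    have "br x n = (k + l') *\<^sub>R n"
      unfolding n_def lie_jacobi[OF lie, of x u v]
      by (simp add: kl lie_linear_simps[OF lie] lie_alt[OF lie] algebra_simps)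
    then show ?thesis
      by (simp add: span_scale span_base)
  qed
  then have "br u n = 0" "br v n = 0"
    using derived_centralizes_line S by blast+
  moreover obtain k l where kl: "n = k *\<^sub>R u + l *\<^sub>R v"
    using coeffs[OF ideal[OF S(4)]] unfolding n_def by blast
  moreover have "br u (k *\<^sub>R u + l *\<^sub>R v) = l *\<^sub>R n" "br v (k *\<^sub>R u + l *\<^sub>R v) = - (k *\<^sub>R n)"
    by (simp_all add: n_def lie_linear_simps[OF lie] lie_alt[OF lie] skew)
  ultimately have "l *\<^sub>R n = 0" "k *\<^sub>R n = 0"
    by auto
  then have "n = 0"
    using kl by (metis add_0 scaleR_eq_0_iff)
  then show ?thesis
    by (simp add: n_def)
qed

lemma derived_subspace_ideal:
  assumes ideal: "\<And>x s. s \<in> S \<Longrightarrow> br x s \<in> S" and "s \<in> derived_subspace br S"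
  shows "br x s \<in> derived_subspace br S"
proof -
  have "s \<in> span {br u v |u v. u \<in> S \<and> v \<in> S}"
    using assms(2) by (simp add: derived_subspace_def)
  then show ?thesis
  proof (induction rule: span_induct)
    case base
    show ?case
      using linear_subspace_vimage[OF lie_linear_right[OF lie] subspace_derived_subspace]
      by (simp add: vimage_def)
  next
    case (step s)
    then obtain u v where s: "s = br u v" "u \<in> S" "v \<in> S"
      by blast
    show ?case
      unfolding s(1) lie_jacobi[OF lie, of x u v]
      by (intro subspace_add subspace_derived_subspace br_in_derived_subspace ideal s)
  qed
qed

end

section \<open>Classification\<close>

text \<open>\<open>forall_4\<close> ranges over 1, 2, 3, 4; the basis of the Lie algebra is indexed
  with 0 in place of 4.\<close>

lemma all_index_4: "(\<forall>i::4. P i) \<longleftrightarrow> P 0 \<and> P 1 \<and> P 2 \<and> P 3"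
proof -
  have zero: "(4::4) = 0"
    by simp
  show ?thesis
    unfolding forall_4 zero by blast
qed

text \<open>The ideal is the kernel of \<open>f\<close>: it is an ideal because it contains all
  brackets, and \<open>e\<close> witnesses codimension 1.\<close>

definition has_abelian_ideal_codim_1 :: "('a::real_vector \<Rightarrow> 'a \<Rightarrow> 'a) \<Rightarrow> bool" where
  "has_abelian_ideal_codim_1 br \<longleftrightarrow> (\<exists>f e. linear f \<and> f e = (1::real) \<and> (\<forall>x y. f (br x y) = 0) \<and>
    (\<forall>x y. f x = 0 \<longrightarrow> f y = 0 \<longrightarrow> br x y = 0))"

context
  fixes br :: "'a::real_vector \<Rightarrow> 'a \<Rightarrow> 'a"
  assumes lie: "lie_algebra br" and dim: "dim (UNIV :: 'a set) = 4"
begin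

section \<open>Structures of type 1 in dimension four\<close>

text \<open>The structure is symplectic on \<open>span {a, b}\<close> and complex on \<open>span {c, d}\<close>.\<close>

lemma gcs_type_1:
  assumes frame: "frame a b c d"
    and ab: "br a b = l *\<^sub>R b" and bc: "br b c = 0" and bd: "br b d = 0"
    and ac: "br a c = p *\<^sub>R c + q *\<^sub>R d + r *\<^sub>R b"
    and ad: "br a d = - q *\<^sub>R c + p *\<^sub>R d + r' *\<^sub>R b"
    and cd: "br c d = s *\<^sub>R b"
  shows "admits_gcs_of_type br 1"
proof -
  obtain A B C D where vals:
    "dual_apply A a = 1" "dual_apply A b = 0" "dual_apply A c = 0" "dual_apply A d = 0"
    "dual_apply B a = 0" "dual_apply B b = 1" "dual_apply B c = 0" "dual_apply B d = 0"
    "dual_apply C a = 0" "dual_apply C b = 0" "dual_apply C c = 1" "dual_apply C d = 0"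
    "dual_apply D a = 0" "dual_apply D b = 0" "dual_apply D c = 0" "dual_apply D d = 1"
    and x_eq: "\<And>x. x = dual_apply A x *\<^sub>R a + dual_apply B x *\<^sub>R b + dual_apply C x *\<^sub>R c
      + dual_apply D x *\<^sub>R d"
    using frame_coords[OF dim frame] by metis
  have vec_eqI: "x = y"
    if "dual_apply A x = dual_apply A y" "dual_apply B x = dual_apply B y"
      "dual_apply C x = dual_apply C y" "dual_apply D x = dual_apply D y" for x y
    using x_eq[of x] x_eq[of y] that by simp
  have dual_eqI': "\<alpha> = \<beta>"
    if "dual_apply \<alpha> a = dual_apply \<beta> a" "dual_apply \<alpha> b = dual_apply \<beta> b"
      "dual_apply \<alpha> c = dual_apply \<beta> c" "dual_apply \<alpha> d = dual_apply \<beta> d" for \<alpha> \<beta>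
  proof (rule dual_eqI)
    fix x
    show "dual_apply \<alpha> x = dual_apply \<beta> x"
      by (subst (1 2) x_eq[of x]) (simp add: dual_apply_linear_simps that)
  qed
  note skew = lie_skew[OF lie]
  have br_basis: "br a a = 0" "br b b = 0" "br c c = 0" "br d d = 0"
    "br b a = - l *\<^sub>R b" "br c b = 0" "br d b = 0"
    "br c a = - (p *\<^sub>R c + q *\<^sub>R d + r *\<^sub>R b)"
    "br d a = - (- q *\<^sub>R c + p *\<^sub>R d + r' *\<^sub>R b)" "br d c = - s *\<^sub>R b"
    using ab bc bd ac ad cd skew[of b a] skew[of c b] skew[of d b] skew[of c a] skew[of d a]
      skew[of d c] by (simp_all add: lie_alt[OF lie])
  have br_coords: "dual_apply A (br x y) = 0"
    "dual_apply C (br x y) =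
      p * (dual_apply A x * dual_apply C y - dual_apply C x * dual_apply A y)
      - q * (dual_apply A x * dual_apply D y - dual_apply D x * dual_apply A y)"
    "dual_apply D (br x y) =
      q * (dual_apply A x * dual_apply C y - dual_apply C x * dual_apply A y)
      + p * (dual_apply A x * dual_apply D y - dual_apply D x * dual_apply A y)"
    "dual_apply B (br x y) =
      l * (dual_apply A x * dual_apply B y - dual_apply B x * dual_apply A y)
      + r * (dual_apply A x * dual_apply C y - dual_apply C x * dual_apply A y)
      + r' * (dual_apply A x * dual_apply D y - dual_apply D x * dual_apply A y)
      + s * (dual_apply C x * dual_apply D y - dual_apply D x * dual_apply C y)" for x y
    by (subst x_eq[of x], subst x_eq[of y],
        simp add: lie_linear_simps[OF lie] br_basis ab bc bd ac ad cd dual_apply_linear_simps vals algebra_simps)+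
  have dual_br: "dual_apply \<alpha> (br x y) = dual_apply B (br x y) * dual_apply \<alpha> b
      + dual_apply C (br x y) * dual_apply \<alpha> c + dual_apply D (br x y) * dual_apply \<alpha> d" for \<alpha> x y
    by (subst (1) x_eq[of "br x y"])
      (simp only: dual_apply_linear_simps br_coords(1) scaleR_zero_left real_scaleR_def add_0_left)
  \<comment> \<open>With i c = d and i d = - c, the hypotheses \<open>ac\<close> and
    \<open>ad\<close> say that \<open>ad a\<close> is multiplication by p + i q modulo
    \<open>b\<close>. The other block is the structure of the form that pairs \<open>a\<close> with
    \<open>b\<close>.\<close>
  define J where "J u =
    (dual_apply (snd u) a *\<^sub>R b - dual_apply (snd u) b *\<^sub>R a
      + dual_apply C (fst u) *\<^sub>R d - dual_apply D (fst u) *\<^sub>R c,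
     dual_apply A (fst u) *\<^sub>R B - dual_apply B (fst u) *\<^sub>R A
      + dual_apply (snd u) c *\<^sub>R D - dual_apply (snd u) d *\<^sub>R C)" for u
  have "linear J"
    by (rule linearI) (auto simp: J_def dual_simps algebra_simps)
  moreover have "J (J u) = - u" for u
    by (auto simp: J_def prod_eq_iff dual_simps vals intro!: vec_eqI dual_eqI')
  moreover have "gc_pairing (J u) (J v) = gc_pairing u v" for u v
  proof -
    have ev: "dual_apply \<alpha> x = dual_apply A x * dual_apply \<alpha> a + dual_apply B x * dual_apply \<alpha> b
      + dual_apply C x * dual_apply \<alpha> c + dual_apply D x * dual_apply \<alpha> d" for \<alpha> x
      by (subst x_eq[of x]) (simp only: dual_apply_linear_simps real_scaleR_def)
    show ?thesis
      unfolding gc_pairing_def ev[of "snd v" "fst u"] ev[of "snd u" "fst v"]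
      by (simp add: J_def dual_simps vals algebra_simps)
  qed
  moreover have "cotangent_bracket br u v + J (cotangent_bracket br (J u) v)
      + J (cotangent_bracket br u (J v)) - cotangent_bracket br (J u) (J v) = 0" for u v
  proof -
    let ?N = "cotangent_bracket br u v + J (cotangent_bracket br (J u) v)
      + J (cotangent_bracket br u (J v)) - cotangent_bracket br (J u) (J v)"
    note cb = fst_cotangent_bracket[OF lie] snd_cotangent_bracket[OF lie]
    note dual_br' = dual_br[of "snd u"] dual_br[of "snd v"]
    have "fst ?N = 0"
      by (rule vec_eqI) (simp_all add: cb J_def dual_simps dual_br' br_coords vals algebra_simps)
    moreover have "snd ?N = 0"
      by (rule dual_eqI') (simp_all add: cb J_def dual_simps dual_br' br_coords vals algebra_simps)
    ultimately show ?thesis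
      by (simp add: prod_eq_iff)
  qed
  ultimately have "generalized_complex_structure br J"
    by (simp add: generalized_complex_structure_def)
  moreover have block: "gc_block2 J \<alpha> = dual_apply \<alpha> a *\<^sub>R b - dual_apply \<alpha> b *\<^sub>R a" for \<alpha>
    by (simp add: gc_block2_def J_def dual_simps)
  have "dim (range (gc_block2 J)) = 2"
  proof (rule dim_unique)
    have "b = gc_block2 J A" "a = gc_block2 J (- B)"
      by (simp_all add: block vals dual_simps)
    then show "{a, b} \<subseteq> range (gc_block2 J)"
      by (metis insert_subset empty_subsetI rangeI)
    show "range (gc_block2 J) \<subseteq> span {a, b}"
      by (intro image_subsetI) (simp add: block span_diff span_scale span_base)
    show "independent {a, b}"
      by (rule independent_mono[OF frame_independent(1)[OF frame]]) simp
    have "a \<noteq> b"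
      using vals by auto
    then show "card {a, b} = 2"
      by simp
  qed
  then have "gc_type J 1"
    unfolding gc_type_def using dim by (intro exI[of _ 2]) simp
  ultimately show ?thesis
    unfolding admits_gcs_of_type_def by blast
qed

text \<open>
  With \<open>h\<close> the ideal and \<open>W = h \<inter> j h\<close>, integrability says that \<open>ad e\<close> preserves \<open>W\<close> and is
  complex linear on it, for a suitable \<open>e \<notin> h\<close>. Then \<open>ad e\<close> has an eigenvector \<open>b \<in> h\<close>
  such that \<open>ad e\<close> is complex linear on \<open>h / b\<close>, for some complex structure on this plane.
\<close>

lemma gcs_type_1_of_abelian_ideal:
  assumes j: "linear j" "\<And>x. j (j x) = - x"
    and N: "\<And>x y. br x y + j (br (j x) y) + j (br x (j y)) - br (j x) (j y) = 0"
    and f: "linear (f :: 'a \<Rightarrow> real)" "f e = 1"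
    and ideal: "\<And>x y. f (br x y) = 0"
    and abelian: "\<And>x y. f x = 0 \<Longrightarrow> f y = 0 \<Longrightarrow> br x y = 0"
  shows "admits_gcs_of_type br 1"
proof -
  note fs = linear_add[OF f(1)] linear_diff[OF f(1)] linear_neg[OF f(1)] linear_cmul[OF f(1)]
    linear_0[OF f(1)]
  note js = linear_add[OF j(1)] linear_diff[OF j(1)] linear_neg[OF j(1)] linear_cmul[OF j(1)]
    linear_0[OF j(1)]
  \<comment> \<open>The vector j e - t e lies in the kernel of \<open>f\<close>, and
    \<open>f\<close> takes the value - (1 + t^2) on its image under \<open>j\<close>. The scaling
    gives f d = 0 and f (j d) = 1, so \<open>e0\<close> is outside the ideal and j e0
    inside.\<close>
  define t where "t = f (j e)"
  define d where "d = (- 1 / (1 + t\<^sup>2)) *\<^sub>R (j e - t *\<^sub>R e)"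
  define e0 where "e0 = j d"
  have t_pos: "1 + t\<^sup>2 \<noteq> 0"
    by (smt (verit) zero_le_power2)
  have je0: "j e0 = - d"
    by (simp add: e0_def j)
  have fd: "f d = 0"
    by (simp add: d_def fs f(2) t_def)
  have "f (j d) = (- 1 / (1 + t\<^sup>2)) * (- 1 - t * t)"
    by (simp add: d_def fs js j f(2) t_def)
  also have "\<dots> = 1"
    using t_pos by (simp add: field_simps power2_eq_square)
  finally have fe0: "f e0 = 1"
    by (simp add: e0_def)
  \<comment> \<open>Subtracting l d from [e0, d] removes the value of f o j, so \<open>m\<close>
    lies in the \<open>j\<close>-invariant part W of the ideal.\<close>
  define l where "l = f (j (br e0 d))"
  define m where "m = br e0 d - l *\<^sub>R d"
  have fm: "f m = 0" "f (j m) = 0"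
    using fe0 by (simp_all add: m_def fs js ideal fd l_def flip: e0_def)
  \<comment> \<open>If \<open>m\<close> is nonzero it is taken as the first basis vector of W, so
    that [e0, d] = l d + w1.\<close>
  have "\<exists>w1. w1 \<noteq> 0 \<and> f w1 = 0 \<and> f (j w1) = 0 \<and> (m \<noteq> 0 \<longrightarrow> w1 = m)"
  proof (cases "m = 0")
    case True
    have "card {e0, d} < 4"
      by (rule le_less_trans[OF card_insert_le_m1]) auto
    then obtain w where w: "w \<notin> span {e0, d}"
      using exists_not_in_span[of "{e0, d}"] dim by auto
    let ?v = "w - f w *\<^sub>R e0 - f (j w) *\<^sub>R d"
    have "?v \<noteq> 0"
      using w by (auto simp: span_breakdown_eq)
    moreover have "f ?v = 0" "f (j ?v) = 0"
      using fe0 by (simp_all add: fs js fd je0 flip: e0_def)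
    ultimately show ?thesis
      using True by blast
  qed (use fm in blast)
  then obtain w1 where w1: "w1 \<noteq> 0" "f w1 = 0" "f (j w1) = 0" "m \<noteq> 0 \<Longrightarrow> w1 = m"
    by blast
  define w2 where "w2 = j w1"
  have jw2: "j w2 = - w1"
    by (simp add: w2_def j)
  have frame: "frame e0 d w1 w2"
    unfolding frame_def
  proof (intro allI impI)
    fix s t u v
    assume z: "s *\<^sub>R e0 + t *\<^sub>R d + u *\<^sub>R w1 + v *\<^sub>R w2 = 0"
    have s: "s = 0"
      using arg_cong[OF z, of f] by (simp add: fs fe0 fd w1 w2_def)
    have t: "t = 0"
      using arg_cong[OF z, of "\<lambda>x. f (j x)"] fe0
      by (simp add: fs js je0 fd w1 jw2 flip: e0_def w2_def) (simp add: w1 w2_def fs)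
    have uv: "u *\<^sub>R w1 + v *\<^sub>R w2 = 0"
      using z s t by simp
    have uv': "u *\<^sub>R w2 - v *\<^sub>R w1 = 0"
      using arg_cong[OF uv, of j] by (simp add: js jw2 flip: w2_def)
    have "(u * u + v * v) *\<^sub>R w1 = u *\<^sub>R (u *\<^sub>R w1 + v *\<^sub>R w2) - v *\<^sub>R (u *\<^sub>R w2 - v *\<^sub>R w1)"
      by (simp add: algebra_simps)
    also have "\<dots> = 0"
      by (simp only: uv uv') simp
    finally have "u * u + v * v = 0"
      using w1(1) by simp
    then show "s = 0 \<and> t = 0 \<and> u = 0 \<and> v = 0"
      using s t by (simp add: sum_squares_eq_zero_iff)
  qed
  obtain E D A B where vals:
    "dual_apply E e0 = 1" "dual_apply E d = 0" "dual_apply E w1 = 0" "dual_apply E w2 = 0"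
    "dual_apply D e0 = 0" "dual_apply D d = 1" "dual_apply D w1 = 0" "dual_apply D w2 = 0"
    "dual_apply A e0 = 0" "dual_apply A d = 0" "dual_apply A w1 = 1" "dual_apply A w2 = 0"
    "dual_apply B e0 = 0" "dual_apply B d = 0" "dual_apply B w1 = 0" "dual_apply B w2 = 1"
    and x_eq: "\<And>x. x = dual_apply E x *\<^sub>R e0 + dual_apply D x *\<^sub>R d + dual_apply A x *\<^sub>R w1
      + dual_apply B x *\<^sub>R w2"
    using frame_coords[OF dim frame] by metis
  have f_E: "f x = dual_apply E x" for x
    by (subst x_eq[of x]) (simp add: fs fe0 fd w1 w2_def)
  have fw2: "f w2 = 0"
    by (simp add: w2_def w1)
  have fj_D: "f (j x) = dual_apply D x" for x
    by (subst x_eq[of x]) (simp add: fs js je0 fd w1 jw2 fe0 fw2 flip: e0_def w2_def)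
  have ab0: "br d w1 = 0" "br d w2 = 0" "br w1 d = 0" "br w2 d = 0" "br w1 w2 = 0"
    using abelian fd w1(2) fw2 by simp_all
  \<comment> \<open>As j e0 = - d lies in the abelian ideal, integrability at (e0, w1) keeps only
    the two terms with \<open>br e0\<close>: the action of \<open>e0\<close> on W is complex
    linear.\<close>
  have jD: "j (br e0 w1) = br e0 w2"
  proof -
    have "br e0 w1 + j (br e0 w2) = 0"
      using N[of e0 w1] ab0 by (simp add: je0 lie_linear_simps[OF lie] js flip: w2_def)
    from arg_cong[OF this, of j] show ?thesis
      by (simp add: js j)
  qed
  define p q where "p = dual_apply A (br e0 w1)" and "q = dual_apply B (br e0 w1)"
  have "dual_apply E (br e0 w1) = 0" "dual_apply D (br e0 w1) = 0"
    by (simp_all add: ideal jD flip: f_E fj_D)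
  then have Dw1: "br e0 w1 = p *\<^sub>R w1 + q *\<^sub>R w2"
    using x_eq[of "br e0 w1"] by (simp add: p_def q_def)
  then have Dw2: "br e0 w2 = - q *\<^sub>R w1 + p *\<^sub>R w2"
    by (simp add: js jw2 flip: jD w2_def)
  have Dd: "br e0 d = l *\<^sub>R d + m"
    by (simp add: m_def)
  show ?thesis
  proof (cases "m = 0")
    case True
    show ?thesis
      by (rule gcs_type_1[OF frame, of l p q 0 0 0]) (simp_all add: Dd True Dw1 Dw2 ab0)
  next
    case False
    then have m: "m = w1"
      using w1(4) by simp
    \<comment> \<open>On W, \<open>ad e0\<close> is multiplication by p + i q, and \<open>Q\<close>
      is |p + i q - l|^2. It vanishes exactly when l is an eigenvalue on W.\<close>
    define Q where "Q = (p - l)\<^sup>2 + q\<^sup>2"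
    show ?thesis
    proof (cases "Q = 0")
      case True
      then have pq: "p = l" "q = 0"
        by (simp_all add: Q_def)
      \<comment> \<open>Now \<open>ad e0\<close> is the scalar l on W. With w1 as eigenvector, it is
        also the scalar l on d and w2 modulo w1, which commutes with any complex structure.\<close>
      have "frame e0 w1 d w2"
        using frame unfolding frame_def by (metis add.assoc add.commute)
      then show ?thesis
        by (rule gcs_type_1[of _ _ _ _ l l 0 1 0 0]) (simp_all add: Dd m Dw1 Dw2 ab0 pq)
    next
      case False
      \<comment> \<open>These are the real and imaginary parts of - 1 / (p + i q - l). Adding the
        corresponding vector of W to \<open>d\<close> cancels w1 and yields an eigenvector for
        l.\<close>
      define n1 n2 where "n1 = - (p - l) / Q" and "n2 = q / Q"
      define b where "b = d + n1 *\<^sub>R w1 + n2 *\<^sub>R w2"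
      have "1 + (p - l) * n1 - q * n2 = 0"
        using False unfolding n1_def n2_def by (simp add: field_simps) (simp add: Q_def power2_eq_square algebra_simps)
      then have eq1: "1 + p * n1 - q * n2 = l * n1"
        by (simp add: algebra_simps)
      have "q * n1 + (p - l) * n2 = 0"
        using False unfolding n1_def n2_def by (simp add: field_simps)
      then have eq2: "q * n1 + p * n2 = l * n2"
        by (simp add: algebra_simps)
      have Db: "br e0 b = l *\<^sub>R b"
      proof -
        have "br e0 b = l *\<^sub>R d + (1 + p * n1 - q * n2) *\<^sub>R w1 + (q * n1 + p * n2) *\<^sub>R w2"
          by (simp add: b_def lie_linear_simps[OF lie] Dd Dw1 Dw2 m algebra_simps)
        also have "\<dots> = l *\<^sub>R b"
          unfolding eq1 eq2 by (simp add: b_def algebra_simps)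
        finally show ?thesis .
      qed
      have "br b w1 = 0" "br b w2 = 0"
        by (simp_all add: b_def lie_linear_simps[OF lie] ab0 lie_alt[OF lie] lie_skew[OF lie, of w2 w1])
      moreover have "frame e0 b w1 w2"
        unfolding frame_def
      proof (intro allI impI)
        fix s t u v
        assume "s *\<^sub>R e0 + t *\<^sub>R b + u *\<^sub>R w1 + v *\<^sub>R w2 = 0"
        then have "s *\<^sub>R e0 + t *\<^sub>R d + (u + t * n1) *\<^sub>R w1 + (v + t * n2) *\<^sub>R w2 = 0"
          by (simp add: b_def algebra_simps)
        from frameD[OF frame this] show "s = 0 \<and> t = 0 \<and> u = 0 \<and> v = 0"
          by auto
      qed
      ultimately show ?thesis
        by (intro gcs_type_1[of e0 b w1 w2 l p q 0 0 0]) (simp_all add: Db Dw1 Dw2 ab0)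
    qed
  qed
qed

section \<open>Case distinction by the derived algebra\<close>

lemma lie_isomorphic_d4I:
  assumes frame: "frame e0 e1 e2 e3"
    and b01: "br e0 e1 = e1" and b02: "br e0 e2 = - e2" and b03: "br e0 e3 = 0"
    and b12: "br e1 e2 = e3" and b13: "br e1 e3 = 0" and b23: "br e2 e3 = 0"
  shows "lie_isomorphic br d4_bracket"
proof -
  obtain A B C D where vals:
    "dual_apply A e0 = 1" "dual_apply A e1 = 0" "dual_apply A e2 = 0" "dual_apply A e3 = 0"
    "dual_apply B e0 = 0" "dual_apply B e1 = 1" "dual_apply B e2 = 0" "dual_apply B e3 = 0"
    "dual_apply C e0 = 0" "dual_apply C e1 = 0" "dual_apply C e2 = 1" "dual_apply C e3 = 0"
    "dual_apply D e0 = 0" "dual_apply D e1 = 0" "dual_apply D e2 = 0" "dual_apply D e3 = 1"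
    and x_eq: "\<And>x. x = dual_apply A x *\<^sub>R e0 + dual_apply B x *\<^sub>R e1 + dual_apply C x *\<^sub>R e2
      + dual_apply D x *\<^sub>R e3"
    using frame_coords[OF dim frame] by metis
  note skew = lie_skew[OF lie]
  have basis: "br e0 e0 = 0" "br e1 e1 = 0" "br e2 e2 = 0" "br e3 e3 = 0"
    "br e1 e0 = - e1" "br e2 e0 = e2" "br e3 e0 = 0" "br e2 e1 = - e3" "br e3 e1 = 0" "br e3 e2 = 0"
    using skew[of e1 e0] skew[of e2 e0] skew[of e3 e0] skew[of e2 e1] skew[of e3 e1] skew[of e3 e2]
    by (simp_all add: lie_alt[OF lie] b01 b02 b03 b12 b13 b23)
  define \<phi> :: "'a \<Rightarrow> real^4" where "\<phi> x = dual_apply A x *\<^sub>R axis 0 1 + dual_apply B x *\<^sub>R axis 1 1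
    + dual_apply C x *\<^sub>R axis 2 1 + dual_apply D x *\<^sub>R axis 3 1" for x
  define \<psi> where "\<psi> y = y$0 *\<^sub>R e0 + y$1 *\<^sub>R e1 + y$2 *\<^sub>R e2 + y$3 *\<^sub>R e3" for y :: "real^4"
  have \<phi>: "\<phi> x $ 0 = dual_apply A x" "\<phi> x $ 1 = dual_apply B x" "\<phi> x $ 2 = dual_apply C x"
    "\<phi> x $ 3 = dual_apply D x" for x
    by (simp_all add: \<phi>_def axis_def)
  have "linear \<phi>"
    by (rule linearI) (simp_all add: \<phi>_def dual_simps algebra_simps)
  moreover have "bij \<phi>"
  proof (rule o_bij)
    show "\<psi> \<circ> \<phi> = id"
      by (rule ext) (simp add: \<psi>_def \<phi> flip: x_eq)
    show "\<phi> \<circ> \<psi> = id"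
      by (rule ext) (simp add: vec_eq_iff all_index_4 \<phi> \<psi>_def dual_simps vals)
  qed
  moreover have "\<phi> (br x y) = d4_bracket (\<phi> x) (\<phi> y)" for x y
  proof -
    have "dual_apply A (br x y) = 0"
      "dual_apply B (br x y) = dual_apply A x * dual_apply B y - dual_apply B x * dual_apply A y"
      "dual_apply C (br x y) = - (dual_apply A x * dual_apply C y - dual_apply C x * dual_apply A y)"
      "dual_apply D (br x y) = dual_apply B x * dual_apply C y - dual_apply C x * dual_apply B y"
      by (subst x_eq[of x], subst x_eq[of y],
        simp add: lie_linear_simps[OF lie] basis b01 b02 b03 b12 b13 b23 dual_simps vals algebra_simps)+
    then show ?thesis
      by (simp add: vec_eq_iff all_index_4 \<phi> d4_bracket_def axis_def)
  qed
  ultimately show ?thesis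
    unfolding lie_isomorphic_def by blast
qed

text \<open>The expression \<open>pf\<close> is the Pfaffian of the matrix of (x, y) -> f [x, y] in
  the frame, so the form is nondegenerate.\<close>

lemma gcs_of_pfaffian:
  assumes frame: "frame a b c d" and f: "linear (f :: 'a \<Rightarrow> real)"
    and pf: "f (br a b) * f (br c d) - f (br a c) * f (br b d) + f (br a d) * f (br b c) \<noteq> 0"
  shows "admits_gcs_of_type br 0"
proof (rule gcs_of_frobenius[OF lie _ _ f])
  show "dim (UNIV :: 'a set) = 2 * 2"
    by (simp add: dim)
  show "(0::nat) < 2"
    by simp
next
  fix z
  assume z: "\<And>y. f (br z y) = 0"
  note fs = linear_add[OF f] linear_diff[OF f] linear_neg[OF f] linear_cmul[OF f] linear_0[OF f]
  obtain A B C D where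
    z_eq: "z = dual_apply A z *\<^sub>R a + dual_apply B z *\<^sub>R b + dual_apply C z *\<^sub>R c
      + dual_apply D z *\<^sub>R d"
    using frame_coords[OF dim frame] by metis
  define s t u v where stuv: "s = dual_apply A z" "t = dual_apply B z" "u = dual_apply C z"
    "v = dual_apply D z"
  have z_eq': "z = s *\<^sub>R a + t *\<^sub>R b + u *\<^sub>R c + v *\<^sub>R d"
    using z_eq by (simp only: stuv)
  note skew = lie_skew[OF lie, of b a] lie_skew[OF lie, of c a] lie_skew[OF lie, of d a]
    lie_skew[OF lie, of c b] lie_skew[OF lie, of d b] lie_skew[OF lie, of d c]
  define ab ac ad bc bd cd where defs: "ab = f (br a b)" "ac = f (br a c)" "ad = f (br a d)"
    "bc = f (br b c)" "bd = f (br b d)" "cd = f (br c d)"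
  have eqs: "t * ab + u * ac + v * ad = 0" "s * ab - u * bc - v * bd = 0"
    "s * ac + t * bc - v * cd = 0" "s * ad + t * bd + u * cd = 0"
    using z[of a] z[of b] z[of c] z[of d] unfolding z_eq'
    by (simp_all add: lie_linear_simps[OF lie] fs skew lie_alt[OF lie] flip: defs)
  have pf': "ab * cd - ac * bd + ad * bc \<noteq> 0"
    using pf by (simp only: defs) simp
  \<comment> \<open>Each coordinate times the Pfaffian is a linear combination of
    \<open>eqs\<close>, as with an adjugate matrix.\<close>
  have "s * (ab * cd - ac * bd + ad * bc) = 0" "t * (ab * cd - ac * bd + ad * bc) = 0"
    "u * (ab * cd - ac * bd + ad * bc) = 0" "v * (ab * cd - ac * bd + ad * bc) = 0"
    using eqs by algebra+
  then show "z = 0"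
    using pf' by (simp add: z_eq')
qed

text \<open>Complements x and y act on the plane by commuting matrices, since [x, y] lies in the
  plane and acts trivially there. For f = s U + t V the Pfaffian is, up to sign, the determinant of
  the images of the row (s, t). If it vanishes for all (s, t), some combination w of x and y
  centralizes the plane, and w, u, v span an abelian ideal.\<close>

lemma abelian_plane_cases:
  assumes u: "u \<noteq> 0" and v: "v \<notin> span {u}" and uv: "br u v = 0"
    and plane: "\<And>x y. br x y \<in> span {u, v}"
  shows "admits_gcs_of_type br 0 \<or> has_abelian_ideal_codim_1 br"
proof -
  obtain x y where frame: "frame x u v y"
    using exists_frame_extending[OF dim u v] by blast
  obtain X U V Y where vals:
    "dual_apply X x = 1" "dual_apply X u = 0" "dual_apply X v = 0" "dual_apply X y = 0"
    "dual_apply U x = 0" "dual_apply U u = 1" "dual_apply U v = 0" "dual_apply U y = 0"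
    "dual_apply V x = 0" "dual_apply V u = 0" "dual_apply V v = 1" "dual_apply V y = 0"
    "dual_apply Y x = 0" "dual_apply Y u = 0" "dual_apply Y v = 0" "dual_apply Y y = 1"
    and x_eq: "\<And>z. z = dual_apply X z *\<^sub>R x + dual_apply U z *\<^sub>R u + dual_apply V z *\<^sub>R v
      + dual_apply Y z *\<^sub>R y"
    using frame_coords[OF dim frame] by metis
  obtain a11 a21 where xu: "br x u = a11 *\<^sub>R u + a21 *\<^sub>R v"
    using span_pairE[OF plane] by blast
  obtain a12 a22 where xv: "br x v = a12 *\<^sub>R u + a22 *\<^sub>R v"
    using span_pairE[OF plane] by blast
  obtain b11 b21 where yu: "br y u = b11 *\<^sub>R u + b21 *\<^sub>R v"
    using span_pairE[OF plane] by blast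
  obtain b12 b22 where yv: "br y v = b12 *\<^sub>R u + b22 *\<^sub>R v"
    using span_pairE[OF plane] by blast
  obtain c1 c2 where xy: "br x y = c1 *\<^sub>R u + c2 *\<^sub>R v"
    using span_pairE[OF plane] by blast
  have vu: "br v u = 0" and alt: "br z z = 0" for z
    using lie_skew[OF lie, of v u] uv lie_alt[OF lie] by simp_all
  have J1: "br x (br y u) = br y (br x u)" and J2: "br x (br y v) = br y (br x v)"
    using lie_jacobi[OF lie, of x y u] lie_jacobi[OF lie, of x y v]
    by (simp_all add: xy lie_linear_simps[OF lie] uv vu alt)
  have comm: "a12 * b21 = b12 * a21" "a11 * b12 + a12 * b22 = b11 * a12 + b12 * a22"
    "a21 * b11 + a22 * b21 = b21 * a11 + b22 * a21"
    using arg_cong[OF J1, of "dual_apply U"] arg_cong[OF J1, of "dual_apply V"]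
      arg_cong[OF J2, of "dual_apply U"]
    by (simp_all add: xu xv yu yv lie_linear_simps[OF lie] dual_simps vals algebra_simps)
  show ?thesis
  proof (cases "\<exists>s t. (s * a11 + t * a21) * (s * b12 + t * b22) \<noteq> (s * a12 + t * a22) * (s * b11 + t * b21)")
    case True
    then obtain s t where
      st: "(s * a11 + t * a21) * (s * b12 + t * b22) \<noteq> (s * a12 + t * a22) * (s * b11 + t * b21)"
      by blast
    let ?f = "dual_apply (s *\<^sub>R U + t *\<^sub>R V)"
    have "?f (br x u) * ?f (br v y) - ?f (br x v) * ?f (br u y) + ?f (br x y) * ?f (br u v)
      = (s * a12 + t * a22) * (s * b11 + t * b21) - (s * a11 + t * a21) * (s * b12 + t * b22)"
      by (simp add: lie_skew[OF lie, of v y] lie_skew[OF lie, of u y] xu xv yu yv uv dual_simps vals algebra_simps)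
    then show ?thesis
      using gcs_of_pfaffian[OF frame linear_dual_apply, of "s *\<^sub>R U + t *\<^sub>R V"] st by simp
  next
    case False
    then obtain \<alpha> \<beta> where ne: "\<alpha> \<noteq> 0 \<or> \<beta> \<noteq> 0" and
      dep: "\<alpha> * a11 + \<beta> * b11 = 0" "\<alpha> * a12 + \<beta> * b12 = 0"
        "\<alpha> * a21 + \<beta> * b21 = 0" "\<alpha> * a22 + \<beta> * b22 = 0"
      using commuting_pencil_dependent[OF comm] by metis
    define Q where "Q = \<alpha>\<^sup>2 + \<beta>\<^sup>2"
    have Q: "Q \<noteq> 0"
      using ne by (simp add: Q_def)
    define w where "w = \<alpha> *\<^sub>R x + \<beta> *\<^sub>R y"
    \<comment> \<open>This functional vanishes on w, u and v; dividing by \<open>Q\<close>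
      normalizes its value at the vector orthogonal to w in the coordinates x, y.\<close>
    define f where "f = dual_apply ((\<beta> / Q) *\<^sub>R X - (\<alpha> / Q) *\<^sub>R Y)"
    have wu: "br w u = 0" "br w v = 0"
    proof -
      have "br w u = (\<alpha> * a11 + \<beta> * b11) *\<^sub>R u + (\<alpha> * a21 + \<beta> * b21) *\<^sub>R v"
        "br w v = (\<alpha> * a12 + \<beta> * b12) *\<^sub>R u + (\<alpha> * a22 + \<beta> * b22) *\<^sub>R v"
        by (simp_all add: w_def lie_linear_simps[OF lie] xu xv yu yv algebra_simps)
      then show "br w u = 0" "br w v = 0"
        by (simp_all add: dep)
    qed
    have uw: "br u w = 0" "br v w = 0"
      using lie_skew[OF lie, of u w] lie_skew[OF lie, of v w] wu by simp_all
    have ker: "\<exists>k l m. z = k *\<^sub>R w + l *\<^sub>R u + m *\<^sub>R v" if "f z = 0" for z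
    proof -
      have "\<beta> * dual_apply X z = \<alpha> * dual_apply Y z"
        using that Q by (simp add: f_def dual_simps)
      \<comment> \<open>The pair (X z, Y z) is parallel to (\<alpha>, \<beta>), and \<open>k\<close>
        is its coefficient, computed by orthogonal projection.\<close>
      define k where "k = (\<alpha> * dual_apply X z + \<beta> * dual_apply Y z) / Q"
      have "(\<alpha> * dual_apply X z + \<beta> * dual_apply Y z) * \<alpha> = dual_apply X z * Q"
        "(\<alpha> * dual_apply X z + \<beta> * dual_apply Y z) * \<beta> = dual_apply Y z * Q"
        using \<open>\<beta> * dual_apply X z = \<alpha> * dual_apply Y z\<close>
        unfolding Q_def power2_eq_square by algebra+
      then have "k * \<alpha> = dual_apply X z" "k * \<beta> = dual_apply Y z"
        using Q by (simp_all add: k_def divide_eq_eq)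
      then have "z = k *\<^sub>R w + dual_apply U z *\<^sub>R u + dual_apply V z *\<^sub>R v"
        by (subst x_eq[of z]) (simp add: w_def algebra_simps)
      then show ?thesis
        by blast
    qed
    have "linear f"
      by (simp add: f_def linear_dual_apply)
    moreover have "f (\<beta> *\<^sub>R x - \<alpha> *\<^sub>R y) = 1"
    proof -
      have "f (\<beta> *\<^sub>R x - \<alpha> *\<^sub>R y) = (\<beta> * \<beta> + \<alpha> * \<alpha>) / Q"
        by (simp add: f_def dual_simps vals add_divide_distrib)
      also have "\<beta> * \<beta> + \<alpha> * \<alpha> = Q"
        by (simp add: Q_def power2_eq_square)
      finally show ?thesis
        using Q by simp
    qed
    moreover have "f (br z z') = 0" for z z'
      by (rule span_pairE[OF plane[of z z']]) (simp add: f_def dual_simps vals)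
    moreover have "br z z' = 0" if zz: "f z = 0" "f z' = 0" for z z'
    proof -
      obtain k l m k' l' m' where "z = k *\<^sub>R w + l *\<^sub>R u + m *\<^sub>R v" "z' = k' *\<^sub>R w + l' *\<^sub>R u + m' *\<^sub>R v"
        using ker[OF zz(1)] ker[OF zz(2)] by blast
      then show ?thesis
        by (simp add: lie_linear_simps[OF lie] wu uw uv vu alt)
    qed
    ultimately show ?thesis
      unfolding has_abelian_ideal_codim_1_def by blast
  qed
qed

text \<open>Let A be the matrix of \<open>ad x\<close> on e1, e2 modulo z. If its trace k is
  nonzero, the form given by the z-coordinate of the bracket has Pfaffian k s. If the trace is 0,
  then A^2 is the scalar - det A, and its sign decides between a rotation, giving type 1, and two
  real eigenvectors, giving the algebra \<open>d4_bracket\<close>.\<close>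

lemma heisenberg_ideal_cases:
  assumes frame: "frame x z e1 e2" and s: "s \<noteq> 0" and det: "a * d - b * c \<noteq> 0"
    and e12: "br e1 e2 = s *\<^sub>R z" and ze: "br z e1 = 0" "br z e2 = 0"
    and xz: "br x z = k *\<^sub>R z"
    and xe1: "br x e1 = a *\<^sub>R e1 + c *\<^sub>R e2 + r1 *\<^sub>R z"
    and xe2: "br x e2 = b *\<^sub>R e1 + d *\<^sub>R e2 + r2 *\<^sub>R z"
  shows "admits_gcs_of_type br 0 \<or> admits_gcs_of_type br 1 \<or> lie_isomorphic br d4_bracket"
proof -
  have z: "z \<noteq> 0"
    using frameD[OF frame, of 0 1 0 0] by auto
  have ez: "br e1 z = 0" "br e2 z = 0" and e21: "br e2 e1 = - s *\<^sub>R z" and alt: "br y y = 0" for y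
    using lie_skew[OF lie, of e1 z] lie_skew[OF lie, of e2 z] lie_skew[OF lie, of e2 e1]
    by (simp_all add: ze e12 lie_alt[OF lie])
  \<comment> \<open>As a derivation, \<open>ad x\<close> multiplies [e1, e2] by the trace of
    A.\<close>
  have "(s * k) *\<^sub>R z = (s * (a + d)) *\<^sub>R z"
    using lie_jacobi[OF lie, of x e1 e2]
    by (simp add: xe1 xe2 e12 e21 xz ez ze alt lie_linear_simps[OF lie] algebra_simps)
  then have k: "k = a + d"
    using z s by simp
  obtain X Z E1 E2 where vals:
    "dual_apply X x = 1" "dual_apply X z = 0" "dual_apply X e1 = 0" "dual_apply X e2 = 0"
    "dual_apply Z x = 0" "dual_apply Z z = 1" "dual_apply Z e1 = 0" "dual_apply Z e2 = 0"
    using frame_coords[OF dim frame] by metis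
  show ?thesis
  proof (cases "k = 0")
    case False
    have "dual_apply Z (br x z) * dual_apply Z (br e1 e2)
      - dual_apply Z (br x e1) * dual_apply Z (br z e2)
      + dual_apply Z (br x e2) * dual_apply Z (br z e1) = k * s"
      by (simp add: xz e12 ze vals dual_simps)
    then show ?thesis
      using gcs_of_pfaffian[OF frame linear_dual_apply, of Z] False s by simp
  next
    case True
    then have d: "d = - a"
      using k by simp
    have xz0: "br x z = 0"
      using xz True by simp
    have zx0: "br z x = 0"
      using lie_skew[OF lie, of z x] xz0 by simp
    define \<delta> where "\<delta> = a * a + b * c"
    have "\<delta> \<noteq> 0"
      using det by (simp add: \<delta>_def d)
    then consider "\<delta> < 0" | "\<delta> > 0"
      by linarith
    then show ?thesis
    proof cases
      case 1
      define \<nu> where "\<nu> = sqrt (- \<delta>)"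
      have \<nu>: "\<nu> \<noteq> 0" "\<nu> * \<nu> = - \<delta>"
        using 1 by (simp_all add: \<nu>_def)
      have c: "c \<noteq> 0"
        using 1 by (auto simp: \<delta>_def not_less)
      \<comment> \<open>Modulo z, \<open>w\<close> is A e1 / \<nu>; hence A e1 = \<nu> w and A w = -
        \<nu> e1, a scaled rotation.\<close>
      define w where "w = (a / \<nu>) *\<^sub>R e1 + (c / \<nu>) *\<^sub>R e2"
      have xw: "br x w = - \<nu> *\<^sub>R e1 + 0 *\<^sub>R w + ((a * r1 + c * r2) / \<nu>) *\<^sub>R z"
      proof -
        have "br x w = ((a * a + b * c) / \<nu>) *\<^sub>R e1 + ((a * r1 + c * r2) / \<nu>) *\<^sub>R z"
          by (simp add: w_def lie_linear_simps[OF lie] xe1 xe2 d algebra_simps add_divide_distrib)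
        moreover have "(a * a + b * c) / \<nu> = - \<nu>"
          using \<nu> by (simp add: field_simps \<delta>_def)
        ultimately show ?thesis
          by simp
      qed
      have xe1': "br x e1 = 0 *\<^sub>R e1 + \<nu> *\<^sub>R w + r1 *\<^sub>R z"
        using \<nu>(1) by (simp add: xe1 w_def scaleR_add_right)
      have "frame x z e1 w"
        unfolding frame_def
      proof (intro allI impI)
        fix p q r t
        assume "p *\<^sub>R x + q *\<^sub>R z + r *\<^sub>R e1 + t *\<^sub>R w = 0"
        then have "p *\<^sub>R x + q *\<^sub>R z + (r + t * (a / \<nu>)) *\<^sub>R e1 + (t * (c / \<nu>)) *\<^sub>R e2 = 0"
          by (simp add: w_def algebra_simps)
        from frameD[OF frame this] show "p = 0 \<and> q = 0 \<and> r = 0 \<and> t = 0"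
          using c \<nu>(1) by auto
      qed
      moreover have "br e1 w = (c / \<nu> * s) *\<^sub>R z" "br z w = 0"
        by (simp_all add: w_def lie_linear_simps[OF lie] alt e12 ze)
      ultimately have "admits_gcs_of_type br 1"
        using xe1' xw ze(1) xz0 by (intro gcs_type_1[of x z e1 w 0 0 \<nu> r1
              "(a * r1 + c * r2) / \<nu>" "c / \<nu> * s"]) simp_all
      then show ?thesis
        by simp
    next
      case 2
      \<comment> \<open>\<open>f1\<close> and \<open>f2\<close> are columns of \<open>A + \<mu>\<close> and \<open>A - \<mu>\<close>, where \<open>A\<^sup>2 = \<delta> = \<mu>\<^sup>2\<close>; the sign of \<open>\<mu>\<close>
        makes them independent, and the multiples of \<open>z\<close> turn them into eigenvectors of \<open>ad x\<close>.\<close>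
      define \<mu> where "\<mu> = (if a \<ge> 0 then sqrt \<delta> else - sqrt \<delta>)"
      have \<mu>: "\<mu> \<noteq> 0" "\<mu> * \<mu> = \<delta>"
        using 2 by (auto simp: \<mu>_def)
      have "sqrt \<delta> > 0"
        using 2 by simp
      then have a\<mu>: "a + \<mu> \<noteq> 0"
        unfolding \<mu>_def by (smt (verit))
      define f1 where "f1 = (a + \<mu>) *\<^sub>R e1 + c *\<^sub>R e2 + (((a + \<mu>) * r1 + c * r2) / \<mu>) *\<^sub>R z"
      define f2 where "f2 = b *\<^sub>R e1 - (a + \<mu>) *\<^sub>R e2 - ((b * r1 - (a + \<mu>) * r2) / \<mu>) *\<^sub>R z"
      \<comment> \<open>Without the factor s this is the determinant - (a + \<mu>)^2 - b c of the
        e1, e2 coordinates of \<open>f1\<close> and \<open>f2\<close>, rewritten by b c = \<mu>^2 -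
        a^2.\<close>
      define \<sigma> where "\<sigma> = (- 2 * \<mu> * (a + \<mu>)) * s"
      have \<sigma>: "\<sigma> \<noteq> 0"
        using \<mu>(1) a\<mu> s by (simp add: \<sigma>_def)
      have bc: "b * c = \<mu> * \<mu> - a * a"
        by (simp add: \<mu>(2) \<delta>_def)
      have xf1: "br x f1 = \<mu> *\<^sub>R f1"
      proof -
        have "br x f1 = ((a + \<mu>) * a + b * c) *\<^sub>R e1 + (\<mu> * c) *\<^sub>R e2 + ((a + \<mu>) * r1 + c * r2) *\<^sub>R z"
          by (simp add: f1_def lie_linear_simps[OF lie] xe1 xe2 xz0 d algebra_simps)
        also have "\<dots> = \<mu> *\<^sub>R f1"
          using \<mu>(1) by (simp add: f1_def bc algebra_simps add_divide_distrib)
        finally show ?thesis .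
      qed
      have xf2: "br x f2 = - (\<mu> *\<^sub>R f2)"
      proof -
        have "br x f2 = (- \<mu> * b) *\<^sub>R e1 + (b * c + a * (a + \<mu>)) *\<^sub>R e2 + (b * r1 - (a + \<mu>) * r2) *\<^sub>R z"
          by (simp add: f2_def lie_linear_simps[OF lie] xe1 xe2 xz0 d algebra_simps)
        also have "\<dots> = - (\<mu> *\<^sub>R f2)"
          using \<mu>(1) by (simp add: f2_def bc algebra_simps add_divide_distrib diff_divide_distrib)
        finally show ?thesis .
      qed
      define m where "m = a + \<mu>"
      have f12: "br f1 f2 = \<sigma> *\<^sub>R z"
      proof -
        have "br f1 f2 = (- (s * ((a + \<mu>) * (a + \<mu>) + b * c))) *\<^sub>R z"
          unfolding f1_def f2_def m_def[symmetric]
          by (simp add: lie_linear_simps[OF lie] alt e12 e21 ez ze algebra_simps)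
        also have "- (s * ((a + \<mu>) * (a + \<mu>) + b * c)) = \<sigma>"
          by (simp add: \<sigma>_def bc algebra_simps)
        finally show ?thesis .
      qed
      have "frame ((1 / \<mu>) *\<^sub>R x) f1 f2 (\<sigma> *\<^sub>R z)"
        unfolding frame_def
      proof (intro allI impI)
        fix p q r t
        assume "p *\<^sub>R ((1 / \<mu>) *\<^sub>R x) + q *\<^sub>R f1 + r *\<^sub>R f2 + t *\<^sub>R (\<sigma> *\<^sub>R z) = 0"
        then have "(p / \<mu>) *\<^sub>R x + (q * (((a + \<mu>) * r1 + c * r2) / \<mu>)
            - r * ((b * r1 - (a + \<mu>) * r2) / \<mu>) + t * \<sigma>) *\<^sub>R z
            + (q * (a + \<mu>) + r * b) *\<^sub>R e1 + (q * c - r * (a + \<mu>)) *\<^sub>R e2 = 0"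
          by (simp add: f1_def f2_def algebra_simps)
        note eqs = frameD[OF frame this]
        have "q * (a + \<mu>) + r * b = 0" "q * c - r * (a + \<mu>) = 0"
          using eqs by simp_all
        then have "q * (2 * \<mu> * (a + \<mu>)) = 0" "r * (2 * \<mu> * (a + \<mu>)) = 0"
          using bc by algebra+
        then have "q = 0" "r = 0"
          using \<mu>(1) a\<mu> by simp_all
        then show "p = 0 \<and> q = 0 \<and> r = 0 \<and> t = 0"
          using eqs \<mu>(1) \<sigma> by simp
      qed
      then have "lie_isomorphic br d4_bracket"
        by (rule lie_isomorphic_d4I)
          (use \<mu>(1) xf1 xf2 f12 in \<open>simp_all add: lie_linear_simps[OF lie] xz0, simp_all add: f1_def f2_def lie_linear_simps[OF lie] ez alt\<close>)
      then show ?thesis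
        by simp
    qed
  qed
qed

text \<open>Dimensions of \<open>G\<close> and \<open>G2\<close> are measured by chosen independent
  vectors. Solvability provides \<open>x\<close> outside \<open>G\<close>, so \<open>G\<close> has
  dimension at most 3. In dimension 3, \<open>G2\<close> is zero, a line, which makes
  \<open>G\<close> a Heisenberg algebra, or contains a plane, which is impossible.\<close>

lemma solvable_cases:
  assumes solv: "lie_solvable br"
  shows "admits_gcs_of_type br 0 \<or> admits_gcs_of_type br 1 \<or> has_abelian_ideal_codim_1 br
    \<or> lie_isomorphic br d4_bracket"
proof -
  define G where "G = derived_subspace br UNIV"
  define G2 where "G2 = derived_subspace br G"
  have br_G: "br x y \<in> G" for x y
    unfolding G_def by (intro br_in_derived_subspace) simp_all
  have ideal_G: "br x s \<in> G" if "s \<in> G" for x s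
    by (rule br_G)
  have ideal_G2: "br x s \<in> G2" if "s \<in> G2" for x s
    using derived_subspace_ideal[OF lie ideal_G] that unfolding G2_def by blast
  have sub: "subspace G" "subspace G2"
    by (simp_all add: G_def G2_def subspace_derived_subspace)
  have G2_G: "G2 \<subseteq> G"
    unfolding G_def G2_def by (rule derived_subspace_mono) simp
  have zero: "0 \<in> G" "0 \<in> G2"
    using sub by (simp_all add: subspace_0)
  obtain u0 :: 'a where u0: "u0 \<noteq> 0"
    using exists_not_in_span[of "{} :: 'a set"] dim by auto
  obtain x where x: "x \<notin> G"
    using lie_solvable_perfect[OF solv, of UNIV] u0 unfolding G_def by blast
  consider (zero) "G \<subseteq> {0}"
    | (line) p where "p \<in> G" "p \<noteq> 0" "G \<subseteq> span {p}"
    | (plane) p q where "p \<in> G" "p \<noteq> 0" "q \<in> G" "q \<notin> span {p}" "G \<subseteq> span {p, q}"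
    | (space) p q r where "p \<in> G" "p \<noteq> 0" "q \<in> G" "q \<notin> span {p}" "r \<in> G" "r \<notin> span {p, q}"
    by (metis insertI1 singletonD subsetI)
  then show ?thesis
  proof cases
    case zero
    then have br0: "br y z = 0" for y z
      using br_G by blast
    have "card {u0} < dim (UNIV :: 'a set)"
      by (simp add: dim)
    then obtain v where "v \<notin> span {u0}"
      using exists_not_in_span[of "{u0}"] by auto
    then show ?thesis
      using abelian_plane_cases[OF u0] by (metis br0 span_zero)
  next
    case (line p)
    have *: "\<exists>k. br y p = k *\<^sub>R p" for y
      using line(3) br_G by (intro in_span_singleton) auto
    then obtain g where g: "\<And>y. br y p = g y *\<^sub>R p"
      by metis
    have "card {p} < dim (UNIV :: 'a set)"
      by (simp add: dim)
    then obtain y0 where y0: "y0 \<notin> span {p}"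
      using exists_not_in_span[of "{p}"] by auto
    obtain x y where frame: "frame x p y0 y"
      using exists_frame_extending[OF dim line(2) y0] by blast
    \<comment> \<open>To reach an abelian plane, \<open>p\<close> needs an independent partner
      commuting with it. The algebra acts on \<open>p\<close> by the character \<open>g\<close>, and
      a combination of two independent vectors lies in its kernel.\<close>
    have "\<exists>v. v \<notin> span {p} \<and> br v p = 0"
    proof (cases "g y0 = 0")
      case True
      then show ?thesis
        using y0 g by auto
    next
      case False
      let ?v = "g y *\<^sub>R y0 - g y0 *\<^sub>R y"
      have "?v \<notin> span {p}"
      proof
        assume "?v \<in> span {p}"
        then obtain k where "?v - k *\<^sub>R p = 0"
          by (auto simp: span_breakdown_eq)
        then have "0 *\<^sub>R x + (- k) *\<^sub>R p + g y *\<^sub>R y0 + (- g y0) *\<^sub>R y = 0"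
          by (simp add: algebra_simps)
        from frameD[OF frame this] show False
          using False by simp
      qed
      moreover have "br ?v p = 0"
        by (simp only: lie_linear_simps[OF lie]) (simp add: g)
      ultimately show ?thesis
        by blast
    qed
    then obtain v where v: "v \<notin> span {p}" "br v p = 0"
      by blast
    have "br p v = 0"
      using lie_skew[OF lie, of p v] v(2) by simp
    moreover have "br y z \<in> span {p, v}" for y z
      using line(3) br_G span_mono[of "{p}" "{p, v}"] by auto
    ultimately show ?thesis
      using abelian_plane_cases[OF line(2) v(1)] by blast
  next
    case (plane p q)
    have "br p q = 0"
      by (rule ideal_plane_abelian[OF lie _ plane(5,1,3) ideal_G]) (simp add: G_def)
    moreover have "br y z \<in> span {p, q}" for y z
      using plane(5) br_G by auto
    ultimately show ?thesis
      using abelian_plane_cases[OF plane(2,4)] by blast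
  next
    case (space p q r)
    have in_G: "k *\<^sub>R u + l *\<^sub>R v + m *\<^sub>R w \<in> G" if "u \<in> G" "v \<in> G" "w \<in> G" for k l m u v w
      using that sub(1) by (intro subspace_add subspace_scale)
    have "span {p, q, r} \<subseteq> G"
      using space sub(1) by (intro span_minimal) auto
    then have "x \<notin> span {p, q, r}"
      using x by blast
    then have frame: "frame x p q r"
      using frame_of_not_in_span space by blast
    have not_plane: "\<exists>w \<in> G. w \<notin> span {u, v}" for u v
    proof (rule ccontr)
      assume "\<not> ?thesis"
      then have "{p, q, r} \<subseteq> span {u, v}"
        using space by auto
      moreover have "independent {p, q, r}"
        by (rule independent_mono[OF frame_independent(1)[OF frame]]) auto
      ultimately have "card {p, q, r} \<le> card {u, v}"
        using independent_span_bound[of "{u, v}" "{p, q, r}"] by simp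
      moreover have "card {p, q, r} = 3"
        using frame_independent(2)[OF frame] by (auto simp: card_insert_if split: if_splits)
      moreover have "card {u, v} \<le> 2"
        using card_length[of "[u, v]"] by simp
      ultimately show False
        by simp
    qed
    consider (zero2) "G2 \<subseteq> {0}"
      | (line2) z where "z \<in> G2" "z \<noteq> 0" "G2 \<subseteq> span {z}"
      | (plane2) u v where "u \<in> G2" "u \<noteq> 0" "v \<in> G2" "v \<notin> span {u}"
      by (metis insertI1 singletonD subsetI)
    then show ?thesis
    proof cases
      case zero2
      obtain X P Q R where vals: "dual_apply X x = 1" "dual_apply X p = 0" "dual_apply X q = 0"
        "dual_apply X r = 0"
        and y_eq: "\<And>y. y = dual_apply X y *\<^sub>R x + dual_apply P y *\<^sub>R p + dual_apply Q y *\<^sub>R q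
          + dual_apply R y *\<^sub>R r"
        using frame_coords[OF dim frame] by metis
      have ker: "y \<in> G" if "dual_apply X y = 0" for y
        using y_eq[of y] that in_G space(1,3,5) by (metis add_0 scaleR_zero_left)
      have X_G: "dual_apply X y = 0" if "y \<in> G" for y
        using subspace_coeff_eq_0[OF sub(1) x in_G[OF space(1,3,5)]] y_eq[of y] that
        by (metis add.assoc)
      have "br y z = 0" if "dual_apply X y = 0" "dual_apply X z = 0" for y z
        using zero2 br_in_derived_subspace[of y G z br] ker that unfolding G2_def by blast
      then have "has_abelian_ideal_codim_1 br"
        unfolding has_abelian_ideal_codim_1_def using vals(1) X_G[OF br_G] linear_dual_apply by metis
      then show ?thesis
        by simp
    next
      case (line2 z)
      have z_G: "z \<in> G"
        using line2(1) G2_G by auto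
      have *: "\<exists>k. y = k *\<^sub>R z" if "y \<in> G2" for y
        using line2(3) that by (intro in_span_singleton) auto
      have "br y z \<in> span {z}" for y
        using ideal_G2 line2 by blast
      \<comment> \<open>The line through \<open>z\<close> is an ideal, so the derived algebra
        \<open>G\<close> centralizes it.\<close>
      then have zc: "br y z = 0" if "y \<in> G" for y
        using derived_centralizes_line[OF lie] that unfolding G_def by blast
      obtain e1 where e1: "e1 \<in> G" "e1 \<notin> span {z}"
        using not_plane[of z z] by auto
      obtain e2 where e2: "e2 \<in> G" "e2 \<notin> span {z, e1}"
        using not_plane by blast
      have "span {z, e1, e2} \<subseteq> G"
        using z_G e1 e2 sub(1) by (intro span_minimal) auto
      then have "x \<notin> span {z, e1, e2}"
        using x by blast
      then have frame': "frame x z e1 e2"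
        using frame_of_not_in_span line2(2) e1(2) e2(2) by blast
      obtain X Z E1 E2 where vals:
        "dual_apply X x = 1" "dual_apply X z = 0" "dual_apply X e1 = 0" "dual_apply X e2 = 0"
        "dual_apply Z x = 0" "dual_apply Z z = 1" "dual_apply Z e1 = 0" "dual_apply Z e2 = 0"
        "dual_apply E1 x = 0" "dual_apply E1 z = 0" "dual_apply E1 e1 = 1" "dual_apply E1 e2 = 0"
        "dual_apply E2 x = 0" "dual_apply E2 z = 0" "dual_apply E2 e1 = 0" "dual_apply E2 e2 = 1"
        and y_eq: "\<And>y. y = dual_apply X y *\<^sub>R x + dual_apply Z y *\<^sub>R z + dual_apply E1 y *\<^sub>R e1
          + dual_apply E2 y *\<^sub>R e2"
        using frame_coords[OF dim frame'] by metis
      have X_G: "dual_apply X y = 0" if "y \<in> G" for y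
        using subspace_coeff_eq_0[OF sub(1) x in_G[OF z_G e1(1) e2(1)]] y_eq[of y] that
        by (metis add.assoc)
      have ez: "br e1 z = 0" "br e2 z = 0" and ze: "br z e1 = 0" "br z e2 = 0"
        and alt: "br y y = 0" for y
        using zc e1(1) e2(1) lie_skew[OF lie, of z e1] lie_skew[OF lie, of z e2]
        by (simp_all add: lie_alt[OF lie])
      obtain k where k: "br x z = k *\<^sub>R z"
        using * ideal_G2 line2(1) by blast
      obtain s where s: "br e1 e2 = s *\<^sub>R z"
        using * br_in_derived_subspace[OF e1(1) e2(1)] unfolding G2_def by blast
      have e21: "br e2 e1 = - s *\<^sub>R z"
        using lie_skew[OF lie, of e2 e1] s by simp
      have "s \<noteq> 0"
      proof
        assume "s = 0"
        have "br y y' = 0" if "y \<in> G" "y' \<in> G" for y y'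
          by (subst y_eq[of y], subst y_eq[of y'])
            (simp add: X_G[OF that(1)] X_G[OF that(2)] lie_linear_simps[OF lie] alt ez ze s e21 \<open>s = 0\<close>)
        then have "z = 0"
          using derived_subspace_linear_eq_0[OF linear_ident, of G br z] line2(1)
          unfolding G2_def by blast
        then show False
          using line2(2) by simp
      qed
      define a b c d where "a = dual_apply E1 (br x e1)" and "b = dual_apply E1 (br x e2)"
        and "c = dual_apply E2 (br x e1)" and "d = dual_apply E2 (br x e2)"
      have xe: "br x e1 = a *\<^sub>R e1 + c *\<^sub>R e2 + dual_apply Z (br x e1) *\<^sub>R z"
        "br x e2 = b *\<^sub>R e1 + d *\<^sub>R e2 + dual_apply Z (br x e2) *\<^sub>R z"
        using y_eq[of "br x e1"] y_eq[of "br x e2"] X_G[OF br_G]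
        by (simp_all add: a_def b_def c_def d_def algebra_simps)
      \<comment> \<open>A singular matrix would give a functional that kills every bracket but not
        both \<open>e1\<close> and \<open>e2\<close>, which lie in \<open>G\<close>.\<close>
      have "a * d - b * c \<noteq> 0"
      proof
        assume "a * d - b * c = 0"
        then obtain l1 l2 where l: "l1 \<noteq> 0 \<or> l2 \<noteq> 0" "l1 * a + l2 * c = 0" "l1 * b + l2 * d = 0"
          by (rule singular_left_kernel)
        let ?F = "dual_apply (l1 *\<^sub>R E1 + l2 *\<^sub>R E2)"
        have Fx: "?F (br x z) = 0" "?F (br x e1) = 0" "?F (br x e2) = 0" "?F (br e1 e2) = 0"
          using l by (simp_all add: dual_simps k s vals flip: a_def b_def c_def d_def)
        then have Fx': "?F (br z x) = 0" "?F (br e1 x) = 0" "?F (br e2 x) = 0" "?F (br e2 e1) = 0"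
          using lie_skew[OF lie, of z x] lie_skew[OF lie, of e1 x] lie_skew[OF lie, of e2 x]
            lie_skew[OF lie, of e2 e1] by (simp_all only: linear_neg[OF linear_dual_apply])
        have "?F (br y y') = 0" for y y'
          by (subst y_eq[of y], subst y_eq[of y'])
            (simp add: lie_linear_simps[OF lie] dual_apply_linear_simps Fx Fx' alt ez ze)
        then have "?F y = 0" if "y \<in> G" for y
          using derived_subspace_linear_eq_0[OF linear_dual_apply] that unfolding G_def by blast
        then have "?F e1 = 0" "?F e2 = 0"
          using e1(1) e2(1) by blast+
        then show False
          using l(1) by (simp add: dual_simps vals)
      qed
      then show ?thesis
        using heisenberg_ideal_cases[OF frame' \<open>s \<noteq> 0\<close> _ s ze k xe] by blast
    next
      \<comment> \<open>Contradictory case. Solvability gives \<open>y\<close> in \<open>G\<close>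
        outside \<open>G2\<close>, so \<open>G2\<close> is the plane of u and v, which is abelian.
        It remains to compare the actions of \<open>y\<close> and \<open>x\<close> on this
        plane.\<close>
      case (plane2 u v)
      have "\<not> G \<subseteq> G2"
        using lie_solvable_perfect[OF solv, of G] space(1,2) unfolding G2_def by auto
      then obtain y where y: "y \<in> G" "y \<notin> G2"
        by blast
      have uv_G: "u \<in> G" "v \<in> G"
        using plane2 G2_G by blast+
      have "span {u, v} \<subseteq> G2"
        using plane2 sub(2) by (intro span_minimal) auto
      then have "y \<notin> span {u, v}"
        using y by blast
      moreover have "span {u, v, y} \<subseteq> G"
        using uv_G y sub(1) by (intro span_minimal) auto
      then have "x \<notin> span {u, v, y}"
        using x by blast
      ultimately have frame': "frame x u v y"
        using frame_of_not_in_span plane2(2,4) by blast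
      obtain X U V Y where vals:
        "dual_apply X x = 1" "dual_apply X u = 0" "dual_apply X v = 0" "dual_apply X y = 0"
        "dual_apply U x = 0" "dual_apply U u = 1" "dual_apply U v = 0" "dual_apply U y = 0"
        "dual_apply V x = 0" "dual_apply V u = 0" "dual_apply V v = 1" "dual_apply V y = 0"
        "dual_apply Y x = 0" "dual_apply Y u = 0" "dual_apply Y v = 0" "dual_apply Y y = 1"
        and z_eq: "\<And>z. z = dual_apply X z *\<^sub>R x + dual_apply U z *\<^sub>R u + dual_apply V z *\<^sub>R v
          + dual_apply Y z *\<^sub>R y"
        using frame_coords[OF dim frame'] by metis
      have X_G: "dual_apply X z = 0" if "z \<in> G" for z
        using subspace_coeff_eq_0[OF sub(1) x in_G[OF uv_G y(1)]] z_eq[of z] that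
        by (metis add.assoc)
      have in_G2: "k *\<^sub>R u + l *\<^sub>R v \<in> G2" for k l
        using plane2 sub(2) by (intro subspace_add subspace_scale)
      have Y_G2: "dual_apply Y z = 0" if "z \<in> G2" for z
      proof -
        have "dual_apply X z = 0"
          using X_G that G2_G by blast
        then have "z = dual_apply Y z *\<^sub>R y + (dual_apply U z *\<^sub>R u + dual_apply V z *\<^sub>R v)"
          using z_eq[of z] by (simp add: add.commute)
        then show ?thesis
          using subspace_coeff_eq_0[OF sub(2) y(2) in_G2] that by metis
      qed
      have G2_eq: "z = dual_apply U z *\<^sub>R u + dual_apply V z *\<^sub>R v" if "z \<in> G2" for z
        using z_eq[of z] X_G[of z] Y_G2[OF that] that G2_G by auto
      have "G2 \<subseteq> span {u, v}"
        using G2_eq by (metis insertI1 insertI2 span_add span_base span_scale subsetI)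
      then have uv: "br u v = 0"
        using ideal_plane_abelian[OF lie _ _ plane2(1,3) ideal_G2] G2_G unfolding G_def by blast
      have vu: "br v u = 0" and alt: "br z z = 0" for z
        using lie_skew[OF lie, of v u] uv by (simp_all add: lie_alt[OF lie])
      define a b c d where "a = dual_apply U (br y u)" and "b = dual_apply U (br y v)"
        and "c = dual_apply V (br y u)" and "d = dual_apply V (br y v)"
      define p11 p12 p21 p22 where "p11 = dual_apply U (br x u)" and "p12 = dual_apply U (br x v)"
        and "p21 = dual_apply V (br x u)" and "p22 = dual_apply V (br x v)"
      define k where "k = dual_apply Y (br x y)"
      have yu: "br y u = a *\<^sub>R u + c *\<^sub>R v" and yv: "br y v = b *\<^sub>R u + d *\<^sub>R v"
        and xu: "br x u = p11 *\<^sub>R u + p21 *\<^sub>R v" and xv: "br x v = p12 *\<^sub>R u + p22 *\<^sub>R v"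
        unfolding a_def b_def c_def d_def p11_def p12_def p21_def p22_def
        by (intro G2_eq ideal_G2 plane2)+
      define h1 h2 where "h1 = dual_apply U (br x y)" and "h2 = dual_apply V (br x y)"
      have xy: "br x y = h1 *\<^sub>R u + h2 *\<^sub>R v + k *\<^sub>R y"
        using z_eq[of "br x y"] X_G[OF br_G] by (simp add: k_def h1_def h2_def)
      note skew = lie_skew[OF lie, of y x] lie_skew[OF lie, of u x] lie_skew[OF lie, of v x]
        lie_skew[OF lie, of u y] lie_skew[OF lie, of v y]
      \<comment> \<open>Otherwise no bracket has a y-component, although \<open>y\<close> lies in
        the derived algebra.\<close>
      have "k \<noteq> 0"
      proof
        assume "k = 0"
        have "dual_apply Y (br z z') = 0" for z z'
          by (subst z_eq[of z], subst z_eq[of z'])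
            (simp add: lie_linear_simps[OF lie] dual_apply_linear_simps skew xu xv yu yv uv vu alt vals \<open>k = 0\<close> flip: k_def)
        then have "dual_apply Y y = 0"
          using derived_subspace_linear_eq_0[OF linear_dual_apply] y(1) unfolding G_def by blast
        then show False
          using vals by simp
      qed
      \<comment> \<open>Otherwise a nonzero functional on the plane kills all brackets of
        \<open>G\<close>, hence \<open>G2\<close>, which contains u and v.\<close>
      moreover have "a * d - b * c \<noteq> 0"
      proof
        assume "a * d - b * c = 0"
        then obtain l1 l2 where l: "l1 \<noteq> 0 \<or> l2 \<noteq> 0" "l1 * a + l2 * c = 0" "l1 * b + l2 * d = 0"
          by (rule singular_left_kernel)
        let ?F = "dual_apply (l1 *\<^sub>R U + l2 *\<^sub>R V)"
        have F: "?F (br y u) = 0" "?F (br y v) = 0"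
          using l by (simp_all add: dual_simps flip: a_def b_def c_def d_def)
        then have F': "?F (br u y) = 0" "?F (br v y) = 0"
          using skew by (simp_all only: linear_neg[OF linear_dual_apply])
        have "?F (br z z') = 0" if "z \<in> G" "z' \<in> G" for z z'
          by (subst z_eq[of z], subst z_eq[of z'])
            (simp only: X_G[OF that(1)] X_G[OF that(2)] lie_linear_simps[OF lie] dual_apply_linear_simps F F' alt uv vu
              scaleR_zero_right scaleR_zero_left add_0_left add_0_right)
        then have "?F z = 0" if "z \<in> G2" for z
          using derived_subspace_linear_eq_0[OF linear_dual_apply] that unfolding G2_def by blast
        then have "?F u = 0" "?F v = 0"
          using plane2 by blast+
        then show False
          using l(1) by (simp add: dual_simps vals)
      qed
      \<comment> \<open>By Jacobi \<open>[B, A] = k A\<close> for \<open>A = ad y\<close> and \<open>B = ad x\<close> on the plane; take the trace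
        after multiplying by the adjugate of \<open>A\<close>.\<close>
      moreover have "2 * (k * (a * d - b * c)) = 0"
      proof -
        have J1: "br x (a *\<^sub>R u + c *\<^sub>R v) = br (br x y) u + br y (br x u)"
          using lie_jacobi[OF lie, of x y u] by (simp only: yu)
        have J2: "br x (b *\<^sub>R u + d *\<^sub>R v) = br (br x y) v + br y (br x v)"
          using lie_jacobi[OF lie, of x y v] by (simp only: yv)
        have "a * p11 + c * p12 = k * a + p11 * a + p21 * b"
          "a * p21 + c * p22 = k * c + p11 * c + p21 * d"
          "b * p11 + d * p12 = k * b + p12 * a + p22 * b"
          "b * p21 + d * p22 = k * d + p12 * c + p22 * d"
          using arg_cong[OF J1, of "dual_apply U"] arg_cong[OF J1, of "dual_apply V"]
            arg_cong[OF J2, of "dual_apply U"] arg_cong[OF J2, of "dual_apply V"]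
          unfolding xy xu xv lie_linear_simps[OF lie] yu yv uv vu alt dual_apply_linear_simps vals
          by (simp_all add: algebra_simps)
        then show ?thesis
          by algebra
      qed
      ultimately show ?thesis
        by simp
    qed
  qed
qed

end

section \<open>The Lie algebra \<open>\<dd>\<^sub>4\<close>\<close>

context
  fixes br :: "'a::real_vector \<Rightarrow> 'a \<Rightarrow> 'a" and J
  assumes lie: "lie_algebra br" and gcs: "generalized_complex_structure br J"
begin

lemma gcs_linear: "linear J"
  and gcs_square: "J (J u) = - u"
  and gcs_pairing: "gc_pairing (J u) (J v) = gc_pairing u v"
  and gcs_integrable: "cotangent_bracket br u v + J (cotangent_bracket br (J u) v)
        + J (cotangent_bracket br u (J v)) - cotangent_bracket br (J u) (J v) = 0"
  using gcs unfolding generalized_complex_structure_def by blast+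

lemma linear_gc_block2: "linear (gc_block2 J)"
  using linear_compose[OF linear_compose[OF _ gcs_linear] linear_fst, of "\<lambda>\<alpha>. (0, \<alpha>)"]
  by (simp add: gc_block2_def[abs_def] o_def linear_iff)

text \<open>Orthogonality and J^2 = -1 make \<open>J\<close> skew-adjoint. On functionals this says
  that \<open>gc_block2 J\<close> is a bivector.\<close>

lemma gc_block2_skew: "dual_apply \<alpha> (gc_block2 J \<beta>) = - dual_apply \<beta> (gc_block2 J \<alpha>)"
proof -
  have "gc_pairing (J (0, \<beta>)) (J (J (0, \<alpha>))) = gc_pairing (0, \<beta>) (J (0, \<alpha>))"
    by (rule gcs_pairing)
  then show ?thesis
    by (simp add: gcs_square gc_pairing_def gc_block2_def dual_simps)
qed

lemma gc_block4_block2: "dual_apply (snd (J (0, \<alpha>))) (gc_block2 J \<alpha>) = 0"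
  using gcs_pairing[of "(0, \<alpha>)" "(0, \<alpha>)"] by (simp add: gc_pairing_def gc_block2_def dual_simps)

text \<open>Two functionals have bracket 0, so integrability reduces to J (0, \<phi>) =
  [J (0, \<alpha>), J (0, \<beta>)], where \<phi> is the Koszul-type bracket of \<alpha> and
  \<beta>. The two conclusions are its components.\<close>

lemma J_dual_bracket:
  assumes "\<And>z. dual_apply \<phi> z = dual_apply \<alpha> (br (gc_block2 J \<beta>) z) - dual_apply \<beta> (br (gc_block2 J \<alpha>) z)"
  shows "gc_block2 J \<phi> = br (gc_block2 J \<alpha>) (gc_block2 J \<beta>)"
    and "dual_apply (snd (J (0, \<phi>))) z =
      dual_apply (snd (J (0, \<alpha>))) (br (gc_block2 J \<beta>) z) - dual_apply (snd (J (0, \<beta>))) (br (gc_block2 J \<alpha>) z)"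
proof -
  note cb = fst_cotangent_bracket[OF lie] snd_cotangent_bracket[OF lie]
  note brs = lie_linear_simps[OF lie]
  have zero: "cotangent_bracket br (0, \<alpha>) (0, \<beta>) = 0"
    by (rule prod_eqI) (auto simp: cb brs dual_simps intro!: dual_eqI)
  have "(0, \<phi>) = cotangent_bracket br (J (0, \<alpha>)) (0, \<beta>) + cotangent_bracket br (0, \<alpha>) (J (0, \<beta>))"
    by (rule prod_eqI) (auto simp: cb brs dual_simps assms gc_block2_def intro!: dual_eqI)
  then have "J (0, \<phi>) = cotangent_bracket br (J (0, \<alpha>)) (J (0, \<beta>))"
    using gcs_integrable[of "(0, \<alpha>)" "(0, \<beta>)"] zero by (simp add: linear_add[OF gcs_linear])
  then show "gc_block2 J \<phi> = br (gc_block2 J \<alpha>) (gc_block2 J \<beta>)"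
    "dual_apply (snd (J (0, \<phi>))) z =
      dual_apply (snd (J (0, \<alpha>))) (br (gc_block2 J \<beta>) z) - dual_apply (snd (J (0, \<beta>))) (br (gc_block2 J \<alpha>) z)"
    by (simp_all add: cb gc_block2_def)
qed

lemma ex_dual_bracket:
  "\<exists>\<phi>. \<forall>z. dual_apply \<phi> z = dual_apply \<alpha> (br x z) - dual_apply \<beta> (br y z)"
  using snd_cotangent_bracket[OF lie, of "(y, \<alpha>)" "(x, \<beta>)"] by (metis add_uminus_conv_diff add.commute fst_conv snd_conv)

text \<open>Pairing the morphism property of \<open>gc_block2 J\<close> with \<gamma> and using
  skew-symmetry shows that the 2-form induced on its image is closed.\<close>

lemma gc_block2_closed:
  "dual_apply \<alpha> (br (gc_block2 J \<beta>) (gc_block2 J \<gamma>)) - dual_apply \<beta> (br (gc_block2 J \<alpha>) (gc_block2 J \<gamma>))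
    + dual_apply \<gamma> (br (gc_block2 J \<alpha>) (gc_block2 J \<beta>)) = 0"
proof -
  obtain \<phi> where \<phi>: "\<And>z. dual_apply \<phi> z =
      dual_apply \<alpha> (br (gc_block2 J \<beta>) z) - dual_apply \<beta> (br (gc_block2 J \<alpha>) z)"
    using ex_dual_bracket by metis
  show ?thesis
    using gc_block2_skew[of \<phi> \<gamma>] by (simp add: \<phi> J_dual_bracket(1)[OF \<phi>])
qed

end

section \<open>Solvability of the model algebra and its structure of type 2\<close>

lemma dim_real4: "dim (UNIV :: (real^4) set) = 4"
  by simp

lemma lie_solvable_d4: "lie_solvable d4_bracket"
proof -
  define D where "D = derived_subspace d4_bracket"
  note zero = derived_subspace_linear_eq_0[where br = d4_bracket, folded D_def]
  have lin: "linear (\<lambda>x. x $ i)" for i :: 4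
    by (rule linearI) simp_all
  \<comment> \<open>Vanishing coordinates bound the derived series by the span of e1, e2, e3, then
    by that of e3, then by 0.\<close>
  have D1: "x $ 0 = 0" if "x \<in> D UNIV" for x
    by (rule zero[OF lin _ that]) (simp add: d4_bracket_def axis_def)
  have D2: "x $ 0 = 0 \<and> x $ 1 = 0 \<and> x $ 2 = 0" if "x \<in> D (D UNIV)" for x
    by (intro conjI; rule zero[OF lin _ that]) (simp_all add: d4_bracket_def axis_def D1)
  have D3: "x = 0" if "x \<in> D (D (D UNIV))" for x
    by (rule zero[OF linear_ident _ that]) (simp add: d4_bracket_def D2)
  have "0 \<in> D (D (D UNIV))"
    unfolding D_def by (rule subspace_0[OF subspace_derived_subspace])
  then have "D (D (D UNIV)) = {0}"
    using D3 by blast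
  then have "(D ^^ 3) UNIV = {0}"
    by (simp add: eval_nat_numeral)
  then show ?thesis
    unfolding lie_solvable_def D_def by blast
qed

lemma d4_type_2: "admits_gcs_of_type d4_bracket 2"
proof (rule gcs_of_complex_structure[OF lie_algebra_d4])
  \<comment> \<open>The witness sends e0 to - e2 and e1 to e3.\<close>
  let ?j = "\<lambda>x :: real^4. x$2 *\<^sub>R axis 0 1 - x$0 *\<^sub>R axis 2 1 + x$1 *\<^sub>R axis 3 1 - x$3 *\<^sub>R axis 1 (1::real)"
  show "dim (UNIV :: (real^4) set) = 2 * 2"
    by simp
  show "linear ?j"
    by (rule linearI) (simp_all add: algebra_simps)
  show "?j (?j x) = - x" for x
    by (simp add: vec_eq_iff all_index_4 axis_def)
  show "d4_bracket x y + ?j (d4_bracket (?j x) y) + ?j (d4_bracket x (?j y)) - d4_bracket (?j x) (?j y) = 0"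
    for x y
    by (simp add: vec_eq_iff all_index_4 axis_def d4_bracket_def algebra_simps)
qed

section \<open>Exclusion of types 0 and 1 for the model algebra\<close>

lemma vec4_eq:
  fixes x :: "real^4"
  shows "x = x$0 *\<^sub>R axis 0 1 + x$1 *\<^sub>R axis 1 1 + x$2 *\<^sub>R axis 2 1 + x$3 *\<^sub>R axis 3 1"
  by (simp add: vec_eq_iff all_index_4 axis_def)

lemma dual_apply_vec4:
  fixes x :: "real^4"
  shows "dual_apply \<alpha> x = x$0 * dual_apply \<alpha> (axis 0 1) + x$1 * dual_apply \<alpha> (axis 1 1)
    + x$2 * dual_apply \<alpha> (axis 2 1) + x$3 * dual_apply \<alpha> (axis 3 1)"
  by (subst vec4_eq[of x]) (simp only: dual_apply_linear_simps real_scaleR_def)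

lemma inner_vec4: "v \<bullet> x = x$0 * v$0 + x$1 * v$1 + x$2 * v$2 + x$3 * v$3" for v x :: "real^4"
  by (subst vec4_eq[of x]) (simp only: inner_add_right inner_scaleR_right inner_axis inner_real_def mult_1_right)

text \<open>Type 0 makes \<open>gc_block2 J\<close> surjective, and a right inverse \<open>W\<close>
  is a closed 2-form. Closedness on the triples (e0, e1, e3), (e0, e2, e3) and (e0, e1, e2) puts e3
  in its kernel, so e3 = 0.\<close>

lemma d4_not_type_0: "\<not> admits_gcs_of_type d4_bracket 0"
proof
  assume "admits_gcs_of_type d4_bracket 0"
  then obtain J where gcs: "generalized_complex_structure d4_bracket J" and type: "gc_type J 0"
    by (auto simp: admits_gcs_of_type_def)
  note lin = linear_gc_block2[OF lie_algebra_d4 gcs]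
  have "dim (range (gc_block2 J)) = DIM(real^4)"
    using type by (auto simp: gc_type_def)
  then have "range (gc_block2 J) = UNIV"
    using linear_subspace_image[OF lin subspace_UNIV] unfolding dim_eq_full by (metis span_eq_iff)
  then have "\<exists>\<alpha>. gc_block2 J \<alpha> = x" for x
    by (metis surj_def)
  then obtain W where W: "\<And>x. gc_block2 J (W x) = x"
    by metis
  let ?e = "\<lambda>i. axis i 1 :: real^4"
  have skew: "dual_apply (W x) y = - dual_apply (W y) x" for x y
    using gc_block2_skew[OF lie_algebra_d4 gcs, of "W x" "W y"] by (simp add: W)
  have closed: "dual_apply (W x) (d4_bracket y z) - dual_apply (W y) (d4_bracket x z)
      + dual_apply (W z) (d4_bracket x y) = 0" for x y z
    using gc_block2_closed[OF lie_algebra_d4 gcs, of "W x" "W y" "W z"] by (simp add: W)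
  have "dual_apply (W (?e 3)) (?e 1) = 0"
    using closed[of "?e 0" "?e 1" "?e 3"] by (simp add: d4_bracket_basis dual_simps)
  moreover have "dual_apply (W (?e 3)) (?e 2) = 0"
    using closed[of "?e 0" "?e 2" "?e 3"] by (simp add: d4_bracket_basis dual_simps)
  moreover have "dual_apply (W (?e 3)) (?e 0) = 0"
    using closed[of "?e 0" "?e 1" "?e 2"] skew[of "?e 1" "?e 2"] skew[of "?e 3" "?e 0"]
    by (simp add: d4_bracket_basis dual_simps)
  moreover have "dual_apply (W (?e 3)) (?e 3) = 0"
    using skew[of "?e 3" "?e 3"] by simp
  ultimately have "dual_apply (W (?e 3)) x = 0" for x
    by (subst dual_apply_vec4) simp
  then have "W (?e 3) = 0"
    by (intro dual_eqI) (simp add: dual_simps)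
  then have "?e 3 = 0"
    using W[of "?e 3"] linear_0[OF lin] by simp
  then show False
    by simp
qed

text \<open>The complex functional T = a + i b has \<Delta> as its real kernel, and
  \<open>act\<close> says that T o ad x is a complex multiple c of T for x in \<Delta>. Comparing
  values on the basis determines \<Delta>.\<close>

lemma d4_plane:
  fixes \<Delta> :: "(real^4) set"
  assumes ind: "\<And>s t. s *\<^sub>R a + t *\<^sub>R b = 0 \<Longrightarrow> s = 0 \<and> t = 0"
    and \<Delta>: "subspace \<Delta>" "dim \<Delta> = 2" "\<And>x. x \<in> \<Delta> \<longleftrightarrow> a \<bullet> x = 0 \<and> b \<bullet> x = 0"
    and act: "\<And>x. x \<in> \<Delta> \<Longrightarrow> \<exists>s t. \<forall>y. a \<bullet> d4_bracket x y = s * (a \<bullet> y) + t * (b \<bullet> y) \<and>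
      b \<bullet> d4_bracket x y = s * (b \<bullet> y) - t * (a \<bullet> y)"
  shows "axis 3 1 \<in> \<Delta>" "axis 1 1 \<in> \<Delta> \<or> axis 2 1 \<in> \<Delta>"
proof -
  define T where "T i = Complex (a $ i) (b $ i)" for i
  have inner_axis': "v \<bullet> axis i 1 = v $ i" for v :: "real^4" and i
    by (simp add: inner_axis)
  have mem: "x \<in> \<Delta> \<longleftrightarrow> x$0 * T 0 + x$1 * T 1 + x$2 * T 2 + x$3 * T 3 = 0" for x
  proof -
    show ?thesis
      by (simp add: \<Delta>(3) complex_eq_iff T_def inner_vec4)
  qed
  have act': "\<exists>c. - x$1 * T 1 + x$2 * T 2 = c * T 0 \<and> x$0 * T 1 - x$2 * T 3 = c * T 1 \<and>
      - x$0 * T 2 + x$1 * T 3 = c * T 2 \<and> 0 = c * T 3" if x: "x \<in> \<Delta>" for x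
  proof -
    obtain s t where st: "\<And>y. a \<bullet> d4_bracket x y = s * (a \<bullet> y) + t * (b \<bullet> y)"
      "\<And>y. b \<bullet> d4_bracket x y = s * (b \<bullet> y) - t * (a \<bullet> y)"
      using act[OF x] by metis
    have br: "d4_bracket x (axis 0 1) = - x$1 *\<^sub>R axis 1 1 + x$2 *\<^sub>R axis 2 1"
      "d4_bracket x (axis 1 1) = x$0 *\<^sub>R axis 1 1 - x$2 *\<^sub>R axis 3 1"
      "d4_bracket x (axis 2 1) = - x$0 *\<^sub>R axis 2 1 + x$1 *\<^sub>R axis 3 1"
      "d4_bracket x (axis 3 1) = 0"
      by (simp_all add: d4_bracket_def axis_def)
    show ?thesis
      using st[of "axis 0 1"] st[of "axis 1 1"] st[of "axis 2 1"] st[of "axis 3 1"]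
      unfolding br
      by (intro exI[of _ "Complex s (- t)"])
        (simp add: complex_eq_iff T_def inner_add_right inner_diff_right inner_axis' algebra_simps)
  qed
  \<comment> \<open>As a and b are independent, T is not a complex multiple of a real
    functional.\<close>
  have dep: False if T: "\<forall>i. T i = complex_of_real (w $ i) * z" for w :: "real^4" and z
  proof -
    have a: "a = Re z *\<^sub>R w" and b: "b = Im z *\<^sub>R w"
      using T by (simp_all add: vec_eq_iff T_def complex_eq_iff mult.commute)
    then have "Im z *\<^sub>R a + (- Re z) *\<^sub>R b = 0"
      by (simp add: mult.commute)
    then have "Re z = 0"
      using ind by fastforce
    then show False
      using a ind[of 1 0] by simp
  qed
  note dep4 = dep[unfolded all_index_4]
  obtain d1 d2 where d: "d1 \<in> \<Delta>" "d2 \<in> \<Delta>" "d1 \<noteq> 0" "d2 \<notin> span {d1}"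
  proof -
    obtain d1 where d1: "d1 \<in> \<Delta>" "d1 \<noteq> 0"
      using \<Delta>(2) dim_eq_0[of \<Delta>] by auto
    have "\<not> \<Delta> \<subseteq> span {d1}"
    proof
      assume "\<Delta> \<subseteq> span {d1}"
      then have "dim \<Delta> \<le> card {d1}"
        by (intro dim_le_card) simp_all
      then show False
        using \<Delta>(2) by simp
    qed
    then show thesis
      using d1 that by blast
  qed
  \<comment> \<open>If T 3 were nonzero, then c = 0, and an element of \<Delta> would be determined
    by its e0-coordinate, against dimension 2.\<close>
  have T3: "T 3 = 0"
  proof (rule ccontr)
    assume "T 3 \<noteq> 0"
    have zero: "x = 0" if x: "x \<in> \<Delta>" "x $ 0 = 0" for x
    proof -
      obtain c where c: "x$0 * T 1 - x$2 * T 3 = c * T 1" "- x$0 * T 2 + x$1 * T 3 = c * T 2" "0 = c * T 3"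
        using act'[OF x(1)] by blast
      have "x $ 2 = 0" "x $ 1 = 0"
        using c x(2) \<open>T 3 \<noteq> 0\<close> by auto
      moreover then have "x $ 3 = 0"
        using mem x \<open>T 3 \<noteq> 0\<close> by simp
      ultimately show "x = 0"
        using x(2) by (simp add: vec_eq_iff all_index_4)
    qed
    have "d1 $ 0 \<noteq> 0"
      using zero d by blast
    moreover have "d1$0 *\<^sub>R d2 - d2$0 *\<^sub>R d1 = 0"
      by (rule zero) (use d \<Delta>(1) in \<open>auto intro!: subspace_diff subspace_scale\<close>)
    ultimately have "d2 = (d2$0 / d1$0) *\<^sub>R d1"
      by (simp add: vec_eq_iff field_simps)
    then show False
      using d(4) by (metis insertI1 span_base span_scale)
  qed
  show e3: "axis 3 1 \<in> \<Delta>"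
    unfolding mem by (simp add: axis_def T3)
  obtain x where x: "x \<in> \<Delta>" "x $ 0 \<noteq> 0 \<or> x $ 1 \<noteq> 0 \<or> x $ 2 \<noteq> 0"
  proof (cases "d1 $ 0 = 0 \<and> d1 $ 1 = 0 \<and> d1 $ 2 = 0")
    case True
    then have d1: "d1 = d1$3 *\<^sub>R axis 3 1"
      by (subst vec4_eq[of d1]) simp
    have "d2 $ 0 \<noteq> 0 \<or> d2 $ 1 \<noteq> 0 \<or> d2 $ 2 \<noteq> 0"
    proof (rule ccontr)
      assume "\<not> ?thesis"
      then have d2: "d2 = d2$3 *\<^sub>R axis 3 1"
        by (subst vec4_eq[of d2]) simp
      have "d1 $ 3 \<noteq> 0"
        using d1 d(3) by auto
      then have "d2 = (d2$3 / d1$3) *\<^sub>R d1"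
        by (subst d2, subst (2) d1) simp
      then show False
        using d(4) by (metis insertI1 span_base span_scale)
    qed
    then show thesis
      using that d by blast
  qed (use that d in blast)
  obtain c where c: "- x$1 * T 1 + x$2 * T 2 = c * T 0" "x$0 * T 1 = c * T 1" "- x$0 * T 2 = c * T 2"
    using act'[OF x(1)] T3 by auto
  have sum: "x$0 * T 0 + x$1 * T 1 + x$2 * T 2 = 0"
    using x(1) mem T3 by simp
  \<comment> \<open>If x_0 is nonzero, c cannot equal both x_0 and - x_0, so T 1 or T 2 vanishes.
    The relation \<open>sum\<close> then makes T a complex multiple of a real vector.\<close>
  have x0: "x $ 0 = 0"
  proof (rule ccontr)
    assume x0: "x $ 0 \<noteq> 0"
    have "(x$0 - c) * T 1 = 0" "(x$0 + c) * T 2 = 0"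
      using c(2) c(3)[symmetric] by (simp_all add: left_diff_distrib distrib_right)
    moreover have "complex_of_real (x$0) - c \<noteq> 0 \<or> complex_of_real (x$0) + c \<noteq> 0"
      using x0 by (auto simp: complex_eq_iff)
    ultimately consider "T 1 = 0" | "T 2 = 0"
      by auto
    then show False
    proof cases
      case 1
      then have "T 0 = (- x$2 / x$0) * T 2"
        using sum x0 by (simp add: field_simps eq_neg_iff_add_eq_0)
      then show False
        using 1 T3 by (intro dep4[of "(- x$2 / x$0) *\<^sub>R axis 0 1 + axis 2 1" "T 2"]) (simp add: axis_def)
    next
      case 2
      then have "T 0 = (- x$1 / x$0) * T 1"
        using sum x0 by (simp add: field_simps eq_neg_iff_add_eq_0)
      then show False
        using 2 T3 by (intro dep4[of "(- x$1 / x$0) *\<^sub>R axis 0 1 + axis 1 1" "T 1"]) (simp add: axis_def)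
    qed
  qed
  have not12: "T 1 \<noteq> 0 \<or> T 2 \<noteq> 0"
    using T3 dep4[of "axis 0 1" "T 0"] by (auto simp: axis_def)
  then have "c = 0"
    using c x0 by auto
  then have xT: "x$1 * T 1 = 0" "x$2 * T 2 = 0"
    using c(1) sum x0 by (auto simp: add_eq_0_iff)
  then consider "T 1 = 0" | "T 2 = 0"
    using x(2) x0 by auto
  then show "axis 1 1 \<in> \<Delta> \<or> axis 2 1 \<in> \<Delta>"
    by cases (simp_all add: mem axis_def)
qed

text \<open>
  Let \<open>\<phi> = - \<beta> \<circ> ad v\<close>, where \<open>J\<^sub>2 \<beta> = e\<^sub>3\<close>. Integrability forces the real functional \<open>\<phi> \<noteq> 0\<close> to
  span a \<open>J\<close>-invariant line.
\<close>

lemma d4_image_contradiction: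
  assumes gcs: "generalized_complex_structure d4_bracket J"
    and range: "range (gc_block2 J) \<subseteq> span {v, axis 3 1}" and v: "v \<in> range (gc_block2 J)"
    and e3: "axis 3 1 \<in> range (gc_block2 J)"
    and br: "\<And>z. d4_bracket v z = (\<sigma> * z $ 0) *\<^sub>R v + \<tau> z *\<^sub>R axis 3 1" and \<sigma>: "\<sigma> \<noteq> 0"
  shows False
proof -
  note lin = gcs_linear[OF lie_algebra_d4 gcs]
  note lin2 = linear_gc_block2[OF lie_algebra_d4 gcs]
  note skew = gc_block2_skew[OF lie_algebra_d4 gcs]
  obtain \<alpha> \<beta> where \<alpha>: "gc_block2 J \<alpha> = v" and \<beta>: "gc_block2 J \<beta> = axis 3 1"
    using v e3 by (metis rangeE)
  have central: "d4_bracket (axis 3 1) z = 0" for z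
    by (simp add: d4_bracket_def axis_def)
  obtain \<phi> where \<phi>: "\<And>z. dual_apply \<phi> z =
      dual_apply \<alpha> (d4_bracket (gc_block2 J \<beta>) z) - dual_apply \<beta> (d4_bracket (gc_block2 J \<alpha>) z)"
    using ex_dual_bracket[OF lie_algebra_d4 gcs] by metis
  \<comment> \<open>With these numbers, \<phi> and the functional part of J (0, \<phi>) are -
    \<sigma> m and - \<sigma> k times the e0-coordinate. Applying \<open>J\<close> to m J \<phi> = k
    \<phi> yields m^2 + k^2 = 0.\<close>
  define m k where "m = dual_apply \<beta> v" and "k = dual_apply (snd (J (0, \<beta>))) v"
  have \<beta>3: "dual_apply \<beta> (axis 3 1) = 0"
    using skew[of \<beta> \<beta>] \<beta> by simp
  have k3: "dual_apply (snd (J (0, \<beta>))) (axis 3 1) = 0"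
    using gc_block4_block2[OF lie_algebra_d4 gcs, of \<beta>] \<beta> by simp
  have \<phi>': "dual_apply \<phi> z = - \<sigma> * z $ 0 * m" for z
    by (simp add: \<phi> \<alpha> \<beta> central br dual_simps \<beta>3 m_def)
  have \<psi>: "dual_apply (snd (J (0, \<phi>))) z = - \<sigma> * z $ 0 * k" for z
    by (simp add: J_dual_bracket(2)[OF lie_algebra_d4 gcs \<phi>] \<alpha> \<beta> central br dual_simps k3 k_def)
  have "d4_bracket v (axis 3 1) = 0"
    by (simp add: d4_bracket_def axis_def)
  then have "fst (J (0, \<phi>)) = 0"
    using J_dual_bracket(1)[OF lie_algebra_d4 gcs \<phi>] \<alpha> \<beta> by (simp add: gc_block2_def)
  then have "m *\<^sub>R J (0, \<phi>) = k *\<^sub>R (0, \<phi>)"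
    by (auto simp: prod_eq_iff dual_simps \<phi>' \<psi> intro!: dual_eqI)
  then have "m *\<^sub>R J (J (0, \<phi>)) = k *\<^sub>R J (0, \<phi>)"
    by (metis linear_cmul[OF lin])
  then have "- (m *\<^sub>R \<phi>) = k *\<^sub>R snd (J (0, \<phi>))"
    unfolding gcs_square[OF lie_algebra_d4 gcs] by (auto dest: arg_cong[of _ _ snd])
  then have "dual_apply (- (m *\<^sub>R \<phi>)) (axis 0 1) = dual_apply (k *\<^sub>R snd (J (0, \<phi>))) (axis 0 1)"
    by simp
  then have "m * (\<sigma> * m) = - k * (\<sigma> * k)"
    by (simp add: dual_simps \<phi>' \<psi>)
  then have "\<sigma> * (m * m + k * k) = 0"
    by (simp add: algebra_simps)
  then have "m = 0"
    using \<sigma> by (simp add: sum_squares_eq_zero_iff)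
  \<comment> \<open>Now \<beta> annihilates the image of \<open>gc_block2 J\<close>, so by
    skew-symmetry every functional vanishes at e3.\<close>
  then have "dual_apply \<beta> x = 0" if "x \<in> {v, axis 3 1}" for x
    using that \<beta>3 by (auto simp: m_def)
  then have "dual_apply \<beta> (gc_block2 J \<gamma>) = 0" for \<gamma>
    using linear_eq_0_on_span[OF linear_dual_apply, of "{v, axis 3 1}" \<beta>] range by blast
  then have "dual_apply \<gamma> (axis 3 1) = 0" for \<gamma> :: "(real^4) dual"
    using skew[of \<gamma> \<beta>] \<beta> by simp
  then have "dual_apply (Abs_dual (\<lambda>x. x $ 3)) (axis 3 1 :: real^4) = 0"
    by blast
  moreover have "linear (\<lambda>x::real^4. x $ 3)"
    by (rule linearI) simp_all
  ultimately show False
    by (simp add: dual_apply_Abs)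
qed

text \<open>The kernel of \<open>gc_block2 J\<close> is the annihilator of its image \<Delta>, a
  \<open>J\<close>-invariant plane of functionals spanned by \<alpha> and \<beta> = J \<alpha>. The
  action of \<Delta> on it commutes with \<open>J\<close>, which is the hypothesis of
  \<open>d4_plane\<close>.\<close>

lemma d4_not_type_1: "\<not> admits_gcs_of_type d4_bracket 1"
proof
  assume "admits_gcs_of_type d4_bracket 1"
  then obtain J where gcs: "generalized_complex_structure d4_bracket J" and type: "gc_type J 1"
    by (auto simp: admits_gcs_of_type_def)
  note lin = gcs_linear[OF lie_algebra_d4 gcs]
  note lin2 = linear_gc_block2[OF lie_algebra_d4 gcs]
  note skew = gc_block2_skew[OF lie_algebra_d4 gcs]
  note square = gcs_square[OF lie_algebra_d4 gcs]
  define \<Delta> where "\<Delta> = range (gc_block2 J)"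
  have \<Delta>: "subspace \<Delta>" "dim \<Delta> = 2"
    using linear_subspace_image[OF lin2 subspace_UNIV] type by (auto simp: \<Delta>_def gc_type_def)
  define \<Delta>' where "\<Delta>' = {y. \<forall>x\<in>\<Delta>. orthogonal x y}"
  have \<Delta>': "subspace \<Delta>'" "dim \<Delta>' = 2"
    using subspace_orthogonal_dim[OF \<Delta>(1)] \<Delta>(2) by (simp_all add: \<Delta>'_def)
  \<comment> \<open>\<open>V\<close> and \<open>F\<close> identify functionals with vectors by the
    inner product, so annihilators become orthogonal complements.\<close>
  define V :: "(real^4) dual \<Rightarrow> real^4" where "V \<alpha> = (\<chi> i. dual_apply \<alpha> (axis i 1))" for \<alpha>
  have V: "dual_apply \<alpha> x = V \<alpha> \<bullet> x" for \<alpha> x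
    by (simp add: dual_apply_vec4[of \<alpha> x] inner_vec4 V_def)
  define F where "F a = Abs_dual (\<lambda>x. a \<bullet> x)" for a :: "real^4"
  have F: "dual_apply (F a) x = a \<bullet> x" for a x
    unfolding F_def by (simp add: dual_apply_Abs linear_iff inner_add_right)
  have VF: "V (F a) = a" for a
    by (simp add: V_def F inner_axis vec_eq_iff)
  have ker: "gc_block2 J \<alpha> = 0 \<longleftrightarrow> V \<alpha> \<in> \<Delta>'" for \<alpha>
  proof -
    have "gc_block2 J \<alpha> = 0 \<longleftrightarrow> (\<forall>\<gamma>. dual_apply \<gamma> (gc_block2 J \<alpha>) = 0)"
      by (metis F inner_eq_zero_iff linear_0[OF linear_dual_apply])
    also have "\<dots> \<longleftrightarrow> (\<forall>\<gamma>. dual_apply \<alpha> (gc_block2 J \<gamma>) = 0)"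
      by (simp add: skew[of _ \<alpha>])
    also have "\<dots> \<longleftrightarrow> V \<alpha> \<in> \<Delta>'"
      by (simp add: V \<Delta>'_def \<Delta>_def orthogonal_def inner_commute)
    finally show ?thesis .
  qed
  obtain a where a: "a \<in> \<Delta>'" "a \<noteq> 0"
    using \<Delta>'(2) dim_eq_0[of \<Delta>'] by auto
  define \<alpha> \<beta> where "\<alpha> = F a" and "\<beta> = snd (J (0, F a))"
  define b where "b = V \<beta>"
  have \<alpha>0: "gc_block2 J \<alpha> = 0"
    unfolding ker \<alpha>_def VF by (rule a)
  have J\<alpha>: "J (0, \<alpha>) = (0, \<beta>)"
    using \<alpha>0 by (simp add: gc_block2_def \<alpha>_def \<beta>_def prod_eq_iff)
  have J\<beta>: "J (0, \<beta>) = (0, - \<alpha>)"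
    using square[of "(0, \<alpha>)"] by (simp add: J\<alpha>)
  have b: "b \<in> \<Delta>'"
    unfolding b_def ker[symmetric] gc_block2_def J\<beta> by simp
  have dual_a: "dual_apply \<alpha> x = a \<bullet> x" and dual_b: "dual_apply \<beta> x = b \<bullet> x" for x
    by (simp_all add: \<alpha>_def F b_def flip: V)
  have J_comb: "J (0, s *\<^sub>R \<alpha> + t *\<^sub>R \<beta>) = (0, s *\<^sub>R \<beta> - t *\<^sub>R \<alpha>)" for s t
  proof -
    have "J (0, s *\<^sub>R \<alpha> + t *\<^sub>R \<beta>) = J (s *\<^sub>R (0, \<alpha>) + t *\<^sub>R (0, \<beta>))"
      by simp
    also have "\<dots> = s *\<^sub>R J (0, \<alpha>) + t *\<^sub>R J (0, \<beta>)"
      by (simp only: linear_add[OF lin] linear_cmul[OF lin])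
    finally show ?thesis
      by (simp add: J\<alpha> J\<beta>)
  qed
  \<comment> \<open>A real relation between \<alpha> and J \<alpha>, combined with its image under
    \<open>J\<close>, gives (s^2 + t^2) \<alpha> = 0.\<close>
  have ind: "s = 0 \<and> t = 0" if "s *\<^sub>R a + t *\<^sub>R b = 0" for s t
  proof -
    have comb: "s *\<^sub>R \<alpha> + t *\<^sub>R \<beta> = 0"
      using that by (intro dual_eqI) (simp add: dual_simps dual_a dual_b flip: inner_add_left inner_scaleR_left)
    have "J (0, 0) = 0"
      using linear_0[OF lin] by (simp add: zero_prod_def)
    then have "s *\<^sub>R \<beta> - t *\<^sub>R \<alpha> = 0"
      using J_comb[of s t] comb by (simp add: zero_prod_def)
    have "(s * s + t * t) *\<^sub>R \<alpha> = s *\<^sub>R (s *\<^sub>R \<alpha> + t *\<^sub>R \<beta>) - t *\<^sub>R (s *\<^sub>R \<beta> - t *\<^sub>R \<alpha>)"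
      by (simp add: algebra_simps)
    also have "\<dots> = 0"
      by (simp only: comb \<open>s *\<^sub>R \<beta> - t *\<^sub>R \<alpha> = 0\<close>) simp
    finally have "s * s + t * t = 0 \<or> \<alpha> = 0"
      by simp
    moreover have "\<alpha> \<noteq> 0"
      using dual_a[of a] a(2) by (auto simp: dual_simps)
    ultimately show ?thesis
      by (simp add: sum_squares_eq_zero_iff)
  qed
  have "a \<noteq> b"
    using ind[of 1 "- 1"] by auto
  have "b \<notin> span {a}"
  proof
    assume "b \<in> span {a}"
    then obtain k where "b = k *\<^sub>R a"
      using in_span_singleton by blast
    then show False
      using ind[of k "- 1"] by simp
  qed
  then have "independent {b, a}"
    using a(2) by (intro independent_insertI) (simp_all add: independent_empty)
  then have "dim {b, a} = 2"
    using \<open>a \<noteq> b\<close> by (simp add: dim_eq_card_independent)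
  then have "span {b, a} = span \<Delta>'"
    using a(1) b \<Delta>'(2) by (intro dim_eq_span) auto
  then have span: "span {a, b} = \<Delta>'"
    using \<Delta>'(1) by (simp add: span_eq_iff[THEN iffD2] insert_commute)
  have mem: "x \<in> \<Delta> \<longleftrightarrow> a \<bullet> x = 0 \<and> b \<bullet> x = 0" for x
  proof -
    define \<Delta>2 where "\<Delta>2 = {y. \<forall>x\<in>\<Delta>'. orthogonal x y}"
    have "subspace \<Delta>2" "dim \<Delta>2 = 2"
      using subspace_orthogonal_dim[OF \<Delta>'(1)] \<Delta>'(2) by (simp_all add: \<Delta>2_def)
    moreover have "\<Delta> \<subseteq> \<Delta>2"
      by (auto simp: \<Delta>2_def \<Delta>'_def orthogonal_commute)
    ultimately have "\<Delta> = \<Delta>2"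
      using \<Delta> by (intro subspace_dim_equal) simp_all
    moreover have "x \<in> \<Delta>2 \<longleftrightarrow> a \<bullet> x = 0 \<and> b \<bullet> x = 0"
    proof
      assume "x \<in> \<Delta>2"
      then show "a \<bullet> x = 0 \<and> b \<bullet> x = 0"
        using a(1) b by (simp add: \<Delta>2_def orthogonal_def)
    next
      assume ab: "a \<bullet> x = 0 \<and> b \<bullet> x = 0"
      have "y \<bullet> x = 0" if "y \<in> \<Delta>'" for y
      proof -
        have "y \<in> span {a, b}"
          using that span by simp
        then obtain k l where "y = k *\<^sub>R a + l *\<^sub>R b"
          by (rule span_pairE)
        then show ?thesis
          using ab by (simp add: inner_add_left)
      qed
      then show "x \<in> \<Delta>2"
        by (simp add: \<Delta>2_def orthogonal_def)
    qed
    ultimately show ?thesis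
      by simp
  qed
  \<comment> \<open>Since gc_block2 J \<alpha> = 0, the induced functional is \<phi> = \<alpha> o ad
    x, and it lies in the kernel again. Its coefficients s, t give the first equation, and
    \<open>J_dual_bracket(2)\<close> gives the second.\<close>
  have act: "\<exists>s t. \<forall>y. a \<bullet> d4_bracket x y = s * (a \<bullet> y) + t * (b \<bullet> y) \<and>
      b \<bullet> d4_bracket x y = s * (b \<bullet> y) - t * (a \<bullet> y)" if x: "x \<in> \<Delta>" for x
  proof -
    obtain \<gamma> where \<gamma>: "gc_block2 J \<gamma> = x"
      using x by (auto simp: \<Delta>_def)
    note brs = lie_linear_simps[OF lie_algebra_d4]
    obtain \<phi> where \<phi>: "\<And>z. dual_apply \<phi> z =
        dual_apply \<alpha> (d4_bracket (gc_block2 J \<gamma>) z) - dual_apply \<gamma> (d4_bracket (gc_block2 J \<alpha>) z)"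
      using ex_dual_bracket[OF lie_algebra_d4 gcs] by metis
    have "gc_block2 J \<phi> = 0"
      by (simp add: J_dual_bracket(1)[OF lie_algebra_d4 gcs \<phi>] \<alpha>0 brs)
    then have "V \<phi> \<in> span {a, b}"
      by (simp add: ker span)
    then obtain s t where st: "V \<phi> = s *\<^sub>R a + t *\<^sub>R b"
      by (rule span_pairE)
    have \<phi>_eq: "\<phi> = s *\<^sub>R \<alpha> + t *\<^sub>R \<beta>"
      by (rule dual_eqI) (simp add: dual_simps dual_a dual_b V[of \<phi>] st inner_add_left)
    have "a \<bullet> d4_bracket x y = s * (a \<bullet> y) + t * (b \<bullet> y)" for y
      using \<phi>[of y] by (simp add: \<phi>_eq \<gamma> \<alpha>0 brs dual_simps dual_a dual_b)
    moreover have "b \<bullet> d4_bracket x y = s * (b \<bullet> y) - t * (a \<bullet> y)" for y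
      using J_dual_bracket(2)[OF lie_algebra_d4 gcs \<phi>, of y]
      by (simp add: \<phi>_eq J_comb J\<alpha> \<gamma> \<alpha>0 brs dual_simps dual_a dual_b)
    ultimately show ?thesis
      by blast
  qed
  note plane = d4_plane[OF ind \<Delta> mem act]
  have spans: "\<Delta> \<subseteq> span {v, axis 3 1}" if "v \<in> \<Delta>" "v \<notin> span {axis 3 1}" for v
  proof -
    have "independent {v, axis 3 1}"
      using that(2) by (intro independent_insertI) (simp_all add: axis_eq_0_iff independent_empty)
    moreover have "v \<noteq> axis 3 1"
      using that(2) by (auto simp: span_base)
    ultimately have "dim {v, axis 3 1} = 2"
      by (simp add: dim_eq_card_independent)
    then have "span {v, axis 3 1} = span \<Delta>"
      using that(1) plane(1) \<Delta>(2) by (intro dim_eq_span) auto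
    then show ?thesis
      by (simp add: span_superset)
  qed
  \<comment> \<open>The instances below come from [e1, z] = - z_0 e1 + z_2 e3 and [e2, z] = z_0 e2 -
    z_1 e3.\<close>
  from plane(2) show False
  proof
    assume v: "axis 1 1 \<in> \<Delta>"
    have "axis 1 1 \<notin> span {axis 3 1 :: real^4}"
      by (auto simp: span_singleton axis_def vec_eq_iff all_index_4)
    then show False
      using v spans[OF v] plane(1)
      by (intro d4_image_contradiction[OF gcs, of "axis 1 1" "- 1" "\<lambda>z. z $ 2"])
        (simp_all add: \<Delta>_def d4_bracket_def axis_def vec_eq_iff)
  next
    assume v: "axis 2 1 \<in> \<Delta>"
    have "axis 2 1 \<notin> span {axis 3 1 :: real^4}"
      by (auto simp: span_singleton axis_def vec_eq_iff all_index_4)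
    then show False
      using v spans[OF v] plane(1)
      by (intro d4_image_contradiction[OF gcs, of "axis 2 1" 1 "\<lambda>z. - z $ 1"])
        (simp_all add: \<Delta>_def d4_bracket_def axis_def vec_eq_iff)
  qed
qed

theorem proposition5p4:
  shows "(lie_algebra d4_bracket \<and> dim (UNIV :: (real^4) set) = 4 \<and> lie_solvable d4_bracket \<and>
      admits_gcs_of_type d4_bracket 2 \<and>
      \<not> admits_gcs_of_type d4_bracket 0 \<and> \<not> admits_gcs_of_type d4_bracket 1) \<and>
    (\<forall>br :: 'a::real_vector \<Rightarrow> 'a \<Rightarrow> 'a.
      lie_algebra br \<longrightarrow> dim (UNIV :: 'a set) = 4 \<longrightarrow> lie_solvable br \<longrightarrow>
      admits_gcs_of_type br 2 \<longrightarrow>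
      \<not> admits_gcs_of_type br 0 \<longrightarrow> \<not> admits_gcs_of_type br 1 \<longrightarrow>
      lie_isomorphic br d4_bracket)"
proof (intro conjI allI impI)
  fix br :: "'a \<Rightarrow> 'a \<Rightarrow> 'a"
  assume lie: "lie_algebra br" and dim: "dim (UNIV :: 'a set) = 4" and solv: "lie_solvable br"
    and type2: "admits_gcs_of_type br 2"
    and not01: "\<not> admits_gcs_of_type br 0" "\<not> admits_gcs_of_type br 1"
  \<comment> \<open>In dimension 4, type 2 is a complex structure. With type 1 excluded, it rules
    out an abelian ideal of codimension 1, one of the four outcomes of
    \<open>solvable_cases\<close>.\<close>
  obtain j where j: "linear j" "\<And>x. j (j x) = - x"
    "\<And>x y. br x y + j (br (j x) y) + j (br x (j y)) - br (j x) (j y) = 0"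
    using complex_structure_of_gcs[OF lie, of 2] dim type2 by auto
  have "\<not> has_abelian_ideal_codim_1 br"
    using gcs_type_1_of_abelian_ideal[OF lie dim j] not01(2)
    unfolding has_abelian_ideal_codim_1_def by blast
  then show "lie_isomorphic br d4_bracket"
    using solvable_cases[OF lie dim solv] not01 by blast
qed (rule lie_algebra_d4 dim_real4 lie_solvable_d4 d4_type_2 d4_not_type_0 d4_not_type_1)+

end
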